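(* The construction $\mathsf{As}$, which sends a finite poset $\mathcal{Q}$ to the operad $\mathsf{As}(\mathcal{Q})$ and a morphism of posets $\phi:\mathcal{Q}_1\to\mathcal{Q}_2$ to the map $\mathsf{As}(\phi)$ defined on generators by $\mathsf{As}(\phi)(\star_x):=\star_{\phi(x)}$ for $x\in\mathcal{Q}_1$, is a functor from the category of finite posets to the category of binary and quadratic nonsymmetric operads. (In particular, for every morphism of posets $\phi$, $\mathsf{As}(\phi)$ extends uniquely to an operad morphism $\mathsf{As}(\mathcal{Q}_1)\to\mathsf{As}(\mathcal{Q}_2)$.)
   Context: All operads are nonsymmetric operads in vector spaces over a field $\mathbb{K}$ of characteristic zero. A morphism of posets $\phi:\mathcal{Q}_1\to\mathcal{Q}_2$ is a map with $x\preccurlyeq y\Rightarrow \phi(x)\preccurlyeq\phi(y)$. For a finite poset $(\mathcal{Q},\preccurlyeq_\mathcal{Q})$ and comparable $a,b\in\mathcal{Q}$, write $a\uparrow_\mathcal{Q} b:=\min(a,b)$. The $\mathcal{Q}$-associative operad $\mathsf{As}(\mathcal{Q})$ is the operad $\mathrm{Free}(\mathfrak{G})/\langle\mathfrak{R}\rangle$, where $\mathfrak{G}=\{\star_a : a\in\mathcal{Q}\}$ is a set of generators of arity $2$ (so $\mathrm{Free}(\mathfrak{G})$ is spanned by binary syntax trees with internal nodes labeled by the $\star_a$), and $\mathfrak{R}$ is the subspace spanned by the elements $\star_a\circ_1\star_b-\star_{a\uparrow_\mathcal{Q} b}\circ_2\star_{a\uparrow_\mathcal{Q} b}$ and $\star_{a\uparrow_\mathcal{Q}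 b}\circ_1\star_{a\uparrow_\mathcal{Q} b}-\star_a\circ_2\star_b$ for all $a,b\in\mathcal{Q}$ with $a\preccurlyeq_\mathcal{Q} b$ or $b\preccurlyeq_\mathcal{Q} a$ (including $a=b$). Here $\star_a$ also denotes its image in $\mathsf{As}(\mathcal{Q})$. *)

theory Defs
  imports "HOL-Algebra.Module" "HOL-Algebra.AbelCoset" "HOL-Library.Tree"
begin

section \<open>Categories and functors\<close>

text \<open>Hom-sets of different pairs of objects need not be disjoint, so the identities, the
  composition and the action of a functor on morphisms take the objects as arguments.\<close>

record ('o, 'm) cat =
  Obj :: "'o set"
  Hom :: "'o \<Rightarrow> 'o \<Rightarrow> 'm set"
  ident :: "'o \<Rightarrow> 'm"
  comp :: "'o \<Rightarrow> 'o \<Rightarrow> 'o \<Rightarrow> 'm \<Rightarrow> 'm \<Rightarrow> 'm"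
    \<comment> \<open>\<open>comp C X Y Z g f\<close> is the composite of \<open>f : X \<rightarrow> Y\<close> followed by \<open>g : Y \<rightarrow> Z\<close>\<close>

locale category =
  fixes C :: "('o, 'm) cat"
  assumes ident_in: "X \<in> Obj C \<Longrightarrow> ident C X \<in> Hom C X X"
    and comp_in:
      "\<lbrakk>X \<in> Obj C; Y \<in> Obj C; Z \<in> Obj C; f \<in> Hom C X Y; g \<in> Hom C Y Z\<rbrakk>
        \<Longrightarrow> comp C X Y Z g f \<in> Hom C X Z"
    and ident_left:
      "\<lbrakk>X \<in> Obj C; Y \<in> Obj C; f \<in> Hom C X Y\<rbrakk> \<Longrightarrow> comp C X Y Y (ident C Y) f = f"
    and ident_right:
      "\<lbrakk>X \<in> Obj C; Y \<in> Obj C; f \<in> Hom C X Y\<rbrakk> \<Longrightarrow> comp C X X Y f (ident C X) = f"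
    and comp_assoc:
      "\<lbrakk>W \<in> Obj C; X \<in> Obj C; Y \<in> Obj C; Z \<in> Obj C;
        f \<in> Hom C W X; g \<in> Hom C X Y; h \<in> Hom C Y Z\<rbrakk>
        \<Longrightarrow> comp C W X Z (comp C X Y Z h g) f = comp C W Y Z h (comp C W X Y g f)"

locale is_functor =
  source: category C + target: category D
  for C :: "('o, 'm) cat" and D :: "('p, 'n) cat" +
  fixes FO :: "'o \<Rightarrow> 'p" and FM :: "'o \<Rightarrow> 'o \<Rightarrow> 'm \<Rightarrow> 'n"
  assumes obj: "X \<in> Obj C \<Longrightarrow> FO X \<in> Obj D"
    and hom: "\<lbrakk>X \<in> Obj C; Y \<in> Obj C; f \<in> Hom C X Y\<rbrakk> \<Longrightarrow> FM X Y f \<in> Hom D (FO X) (FO Y)"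
    and preserves_ident: "X \<in> Obj C \<Longrightarrow> FM X X (ident C X) = ident D (FO X)"
    and preserves_comp:
      "\<lbrakk>X \<in> Obj C; Y \<in> Obj C; Z \<in> Obj C; f \<in> Hom C X Y; g \<in> Hom C Y Z\<rbrakk>
        \<Longrightarrow> FM X Z (comp C X Y Z g f)
            = comp D (FO X) (FO Y) (FO Z) (FM Y Z g) (FM X Y f)"


section \<open>Finite posets\<close>

text \<open>A poset is represented by its order relation \<open>Q\<close>; its underlying set is \<open>Field Q\<close>.
  Morphisms are undefined outside the underlying set of their source.\<close>

definition poset_hom :: "'a rel \<Rightarrow> 'a rel \<Rightarrow> ('a \<Rightarrow> 'a) set" where
  "poset_hom Q1 Q2 = {\<phi> \<in> Field Q1 \<rightarrow>\<^sub>E Field Q2. compat Q1 Q2 \<phi>}"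

definition finite_posets :: "('a rel, 'a \<Rightarrow> 'a) cat" where
  "finite_posets =
    \<lparr>Obj = {Q. finite (Field Q) \<and> Partial_order Q},
     Hom = poset_hom,
     ident = (\<lambda>Q. \<lambda>x\<in>Field Q. x),
     comp = (\<lambda>Q1 Q2 Q3 \<psi> \<phi>. compose (Field Q1) \<psi> \<phi>)\<rparr>"


section \<open>Nonsymmetric operads\<close>

definition linear_map ::
  "('k, 'r) ring_scheme \<Rightarrow> ('k, 'x) module \<Rightarrow> ('k, 'y) module \<Rightarrow> ('x \<Rightarrow> 'y) \<Rightarrow> bool" where
  "linear_map K M N f \<longleftrightarrow>
    f \<in> carrier M \<rightarrow> carrier N \<and>
    (\<forall>x\<in>carrier M. \<forall>y\<in>carrier M. f (x \<oplus>\<^bsub>M\<^esub> y) = f x \<oplus>\<^bsub>N\<^esub> f y) \<and>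
    (\<forall>c\<in>carrier K. \<forall>x\<in>carrier M. f (c \<odot>\<^bsub>M\<^esub> x) = c \<odot>\<^bsub>N\<^esub> f x)"

definition linear_span :: "('k, 'r) ring_scheme \<Rightarrow> ('k, 'x) module \<Rightarrow> 'x set \<Rightarrow> 'x set" where
  "linear_span K M S = \<Inter>{N. submodule N K M \<and> S \<subseteq> N}"

record ('k, 'x) operad =
  space :: "nat \<Rightarrow> ('k, 'x) module"
  circ :: "nat \<Rightarrow> nat \<Rightarrow> nat \<Rightarrow> 'x \<Rightarrow> 'x \<Rightarrow> 'x"
    \<comment> \<open>\<open>circ P n m i x y\<close> is the partial composition of \<open>x\<close> of arity \<open>n\<close> with \<open>y\<close> of
        arity \<open>m\<close> at the input \<open>i\<close> of \<open>x\<close>, inputs being numbered from 1\<close>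
  operad_unit :: 'x

abbreviation elems :: "('k, 'x) operad \<Rightarrow> nat \<Rightarrow> 'x set" where
  "elems P n \<equiv> carrier (space P n)"

locale ns_operad =
  fixes K :: "('k, 'r) ring_scheme" and P :: "('k, 'x) operad"
  assumes base_field: "field K"
    and vector_space: "module K (space P n)"
    and unit_in: "operad_unit P \<in> elems P 1"
    and circ_linear_left:
      "\<lbrakk>1 \<le> i; i \<le> n; y \<in> elems P m\<rbrakk>
        \<Longrightarrow> linear_map K (space P n) (space P (n + m - 1)) (\<lambda>x. circ P n m i x y)"
    and circ_linear_right:
      "\<lbrakk>1 \<le> i; i \<le> n; x \<in> elems P n\<rbrakk>
        \<Longrightarrow> linear_map K (space P m) (space P (n + m - 1)) (\<lambda>y. circ P n m i x y)"
    and unit_left: "x \<in> elems P n \<Longrightarrow> circ P 1 n 1 (operad_unit P) x = x"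
    and unit_right:
      "\<lbrakk>1 \<le> i; i \<le> n; x \<in> elems P n\<rbrakk> \<Longrightarrow> circ P n 1 i x (operad_unit P) = x"
    and assoc_sequential:
      "\<lbrakk>1 \<le> i; i \<le> n; 1 \<le> j; j \<le> m; x \<in> elems P n; y \<in> elems P m; z \<in> elems P p\<rbrakk>
        \<Longrightarrow> circ P (n + m - 1) p (i + j - 1) (circ P n m i x y) z
            = circ P n (m + p - 1) i x (circ P m p j y z)"
    and assoc_parallel:
      "\<lbrakk>1 \<le> i; i < k; k \<le> n; x \<in> elems P n; y \<in> elems P m; z \<in> elems P p\<rbrakk>
        \<Longrightarrow> circ P (n + m - 1) p (k + m - 1) (circ P n m i x y) z
            = circ P (n + p - 1) m i (circ P n p k x z) y"

text \<open>A morphism is a family of maps, one for each arity, each undefined outside the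
  corresponding component of the source.\<close>

definition operad_hom ::
  "('k, 'r) ring_scheme \<Rightarrow> ('k, 'x) operad \<Rightarrow> ('k, 'y) operad \<Rightarrow> (nat \<Rightarrow> 'x \<Rightarrow> 'y) set" where
  "operad_hom K P P' =
    {F. (\<forall>n. F n \<in> extensional (elems P n)) \<and>
        (\<forall>n. linear_map K (space P n) (space P' n) (F n)) \<and>
        F 1 (operad_unit P) = operad_unit P' \<and>
        (\<forall>n m i. \<forall>x\<in>elems P n. \<forall>y\<in>elems P m. 1 \<le> i \<and> i \<le> n \<longrightarrow>
          F (n + m - 1) (circ P n m i x y) = circ P' n m i (F n x) (F m y))}"

definition isomorphic_operads ::
  "('k, 'r) ring_scheme \<Rightarrow> ('k, 'x) operad \<Rightarrow> ('k, 'y) operad \<Rightarrow> bool" where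
  "isomorphic_operads K P P' \<longleftrightarrow>
    (\<exists>F\<in>operad_hom K P P'. \<forall>n. bij_betw (F n) (elems P n) (elems P' n))"


subsection \<open>Ideals and quotients\<close>

definition operad_ideal ::
  "('k, 'r) ring_scheme \<Rightarrow> ('k, 'x) operad \<Rightarrow> (nat \<Rightarrow> 'x set) \<Rightarrow> bool" where
  "operad_ideal K P I \<longleftrightarrow>
    (\<forall>n. submodule (I n) K (space P n)) \<and>
    (\<forall>n m i. 1 \<le> i \<and> i \<le> n \<longrightarrow>
      (\<forall>x\<in>I n. \<forall>y\<in>elems P m. circ P n m i x y \<in> I (n + m - 1)) \<and>
      (\<forall>x\<in>elems P n. \<forall>y\<in>I m. circ P n m i x y \<in> I (n + m - 1)))"

definition generated_ideal ::
  "('k, 'r) ring_scheme \<Rightarrow> ('k, 'x) operad \<Rightarrow> (nat \<Rightarrow> 'x set) \<Rightarrow> nat \<Rightarrow> 'x set" where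
  "generated_ideal K P R n = \<Inter>{I n | I. operad_ideal K P I \<and> (\<forall>m. R m \<subseteq> I m)}"

text \<open>The fields \<open>mult\<close> and \<open>one\<close> of a module record play no role in a module.\<close>

definition quotient_module ::
  "('k, 'x) module \<Rightarrow> 'x set \<Rightarrow> ('k, 'x set) module" where
  "quotient_module M N =
    \<lparr>carrier = a_rcosets\<^bsub>M\<^esub> N,
     mult = undefined,
     one = undefined,
     zero = N,
     add = set_add M,
     smult = (\<lambda>c X. \<Union>x\<in>X. N +>\<^bsub>M\<^esub> (c \<odot>\<^bsub>M\<^esub> x))\<rparr>"

definition quotient_operad ::
  "('k, 'x) operad \<Rightarrow> (nat \<Rightarrow> 'x set) \<Rightarrow> ('k, 'x set) operad" where
  "quotient_operad P I =
    \<lparr>space = (\<lambda>n. quotient_module (space P n) (I n)),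
     circ = (\<lambda>n m i X Y.
       \<Union>x\<in>X. \<Union>y\<in>Y. I (n + m - 1) +>\<^bsub>space P (n + m - 1)\<^esub> circ P n m i x y),
     operad_unit = I 1 +>\<^bsub>space P 1\<^esub> operad_unit P\<rparr>"


subsection \<open>Free operads on binary generators\<close>

text \<open>\<open>size1 t\<close> is the number of leaves of \<open>t\<close>, that is, the arity of the syntax tree \<open>t\<close>.\<close>

definition syntax_trees :: "'g set \<Rightarrow> nat \<Rightarrow> 'g tree set" where
  "syntax_trees G n = {t. set_tree t \<subseteq> G \<and> size1 t = n}"

text \<open>\<open>graft t i u\<close> replaces the \<open>i\<close>-th leaf of \<open>t\<close> (from left to right, starting at 1)
  by \<open>u\<close>.\<close>

fun graft :: "'g tree \<Rightarrow> nat \<Rightarrow> 'g tree \<Rightarrow> 'g tree" where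
  "graft Leaf i u = u"
| "graft (Node l a r) i u =
    (if i \<le> size1 l then Node (graft l i u) a r else Node l a (graft r (i - size1 l) u))"

definition free_module :: "('k, 'r) ring_scheme \<Rightarrow> 'b set \<Rightarrow> ('k, 'b \<Rightarrow> 'k) module" where
  "free_module K B =
    \<lparr>carrier = {f. range f \<subseteq> carrier K \<and> finite {b. f b \<noteq> \<zero>\<^bsub>K\<^esub>} \<and> {b. f b \<noteq> \<zero>\<^bsub>K\<^esub>} \<subseteq> B},
     mult = undefined,
     one = undefined,
     zero = (\<lambda>b. \<zero>\<^bsub>K\<^esub>),
     add = (\<lambda>f g b. f b \<oplus>\<^bsub>K\<^esub> g b),
     smult = (\<lambda>c f b. c \<otimes>\<^bsub>K\<^esub> f b)\<rparr>"

definition basis_elem :: "('k, 'r) ring_scheme \<Rightarrow> 'b \<Rightarrow> 'b \<Rightarrow> 'k" where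
  "basis_elem K b = (\<lambda>c. if c = b then \<one>\<^bsub>K\<^esub> else \<zero>\<^bsub>K\<^esub>)"

text \<open>The composition is the bilinear extension of grafting. The index set of the sum has at
  most one element: \<open>n\<close>, \<open>m\<close>, \<open>i\<close> and the grafted tree determine the two trees.\<close>

definition free_operad :: "('k, 'r) ring_scheme \<Rightarrow> 'g set \<Rightarrow> ('k, 'g tree \<Rightarrow> 'k) operad" where
  "free_operad K G =
    \<lparr>space = (\<lambda>n. free_module K (syntax_trees G n)),
     circ = (\<lambda>n m i f g t.
       \<Oplus>\<^bsub>K\<^esub>p\<in>{p \<in> syntax_trees G n \<times> syntax_trees G m. graft (fst p) i (snd p) = t}.
         f (fst p) \<otimes>\<^bsub>K\<^esub> g (snd p)),
     operad_unit = basis_elem K Leaf\<rparr>"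

definition generator :: "('k, 'r) ring_scheme \<Rightarrow> 'g \<Rightarrow> 'g tree \<Rightarrow> 'k" where
  "generator K a = basis_elem K (Node Leaf a Leaf)"


subsection \<open>Binary and quadratic operads\<close>

definition concentrated :: "nat \<Rightarrow> 'x set \<Rightarrow> nat \<Rightarrow> 'x set" where
  "concentrated k S = (\<lambda>n. if n = k then S else {})"

definition presented_operad ::
  "('k, 'r) ring_scheme \<Rightarrow> 'g set \<Rightarrow> (nat \<Rightarrow> ('g tree \<Rightarrow> 'k) set)
    \<Rightarrow> ('k, ('g tree \<Rightarrow> 'k) set) operad" where
  "presented_operad K G R =
    quotient_operad (free_operad K G) (generated_ideal K (free_operad K G) R)"

text \<open>An operad is binary and quadratic if it has a presentation with generators of arity 2 and
  a space of relations consisting of combinations of trees with exactly two internal nodes; for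
  binary trees, these are the trees of arity 3. As there are no relations in arity 2, the
  generators embed into the operad, so it is no restriction to take them in the type \<open>'x\<close>.\<close>

definition binary_quadratic :: "('k, 'r) ring_scheme \<Rightarrow> ('k, 'x) operad \<Rightarrow> bool" where
  "binary_quadratic K P \<longleftrightarrow>
    (\<exists>(G :: 'x set) R. submodule R K (space (free_operad K G) 3) \<and>
      isomorphic_operads K P (presented_operad K G (concentrated 3 R)))"

definition binary_quadratic_operads ::
  "('k, 'r) ring_scheme \<Rightarrow> (('k, 'x) operad, nat \<Rightarrow> 'x \<Rightarrow> 'x) cat" where
  "binary_quadratic_operads K =
    \<lparr>Obj = {P. ns_operad K P \<and> binary_quadratic K P},
     Hom = operad_hom K,
     ident = (\<lambda>P n. \<lambda>x\<in>elems P n. x),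
     comp = (\<lambda>P1 P2 P3 G F n. compose (elems P1 n) (G n) (F n))\<rparr>"


section \<open>The operad of a poset\<close>

definition comparable :: "'a rel \<Rightarrow> 'a \<Rightarrow> 'a \<Rightarrow> bool" where
  "comparable Q a b \<longleftrightarrow> (a, b) \<in> Q \<or> (b, a) \<in> Q"

definition poset_min :: "'a rel \<Rightarrow> 'a \<Rightarrow> 'a \<Rightarrow> 'a" where
  "poset_min Q a b = (if (a, b) \<in> Q then a else b)"

definition As_relators :: "('k, 'r) ring_scheme \<Rightarrow> 'a rel \<Rightarrow> ('a tree \<Rightarrow> 'k) set" where
  "As_relators K Q =
    (let F = free_operad K (Field Q); g = generator K; c = circ F 2 2 in
      {c 1 (g a) (g b) \<ominus>\<^bsub>space F 3\<^esub> c 2 (g (poset_min Q a b)) (g (poset_min Q a b))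
        | a b. comparable Q a b} \<union>
      {c 1 (g (poset_min Q a b)) (g (poset_min Q a b)) \<ominus>\<^bsub>space F 3\<^esub> c 2 (g a) (g b)
        | a b. comparable Q a b})"

definition As_relations :: "('k, 'r) ring_scheme \<Rightarrow> 'a rel \<Rightarrow> nat \<Rightarrow> ('a tree \<Rightarrow> 'k) set" where
  "As_relations K Q =
    concentrated 3 (linear_span K (space (free_operad K (Field Q)) 3) (As_relators K Q))"

definition As :: "('k, 'r) ring_scheme \<Rightarrow> 'a rel \<Rightarrow> ('k, ('a tree \<Rightarrow> 'k) set) operad" where
  "As K Q = presented_operad K (Field Q) (As_relations K Q)"

text \<open>The image of the generator labelled by \<open>a\<close> in the quotient.\<close>

definition star :: "('k, 'r) ring_scheme \<Rightarrow> 'a rel \<Rightarrow> 'a \<Rightarrow> ('a tree \<Rightarrow> 'k) set" where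
  "star K Q a =
    (let F = free_operad K (Field Q)
     in generated_ideal K F (As_relations K Q) 2 +>\<^bsub>space F 2\<^esub> generator K a)"

definition extends_on_generators ::
  "('k, 'r) ring_scheme \<Rightarrow> 'a rel \<Rightarrow> 'a rel \<Rightarrow> ('a \<Rightarrow> 'a)
    \<Rightarrow> (nat \<Rightarrow> ('a tree \<Rightarrow> 'k) set \<Rightarrow> ('a tree \<Rightarrow> 'k) set) \<Rightarrow> bool" where
  "extends_on_generators K Q1 Q2 \<phi> F \<longleftrightarrow>
    F \<in> operad_hom K (As K Q1) (As K Q2) \<and>
    (\<forall>x\<in>Field Q1. F 2 (star K Q1 x) = star K Q2 (\<phi> x))"

definition As_map ::
  "('k, 'r) ring_scheme \<Rightarrow> 'a rel \<Rightarrow> 'a rel \<Rightarrow> ('a \<Rightarrow> 'a)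
    \<Rightarrow> nat \<Rightarrow> ('a tree \<Rightarrow> 'k) set \<Rightarrow> ('a tree \<Rightarrow> 'k) set" where
  "As_map K Q1 Q2 \<phi> = (THE F. extends_on_generators K Q1 Q2 \<phi> F)"

end

theory Submission
  imports Defs
begin

text \<open>The components of a free operad are free modules on trees, so identities between multilinear
  expressions, among them the operad axioms, may be checked on trees, where they are identities about
  grafting. A relabelling of the generators acts on trees, hence on free operads. A morphism of posets
  commutes with \<open>min\<close> on comparable pairs, so its relabelling maps relators to relators and
  descends to the quotients. Every tree is obtained from generators by partial composition, so a
  morphism out of a quotient of a free operad is determined by its values on the generators;
  functoriality follows from this uniqueness.\<close>

section \<open>Linear maps and quotient modules\<close>

text \<open>Some obstacles shape the details. A coefficient of a partial composition in the free
  operad is a sum over all pairs of trees with a given graft; that such a pair is unique once the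
  arities and the position are fixed is what reduces composites of basis elements to grafting.
  Quotients consist of cosets, and their operations are unions over representatives, so each
  construction on them needs a proof that the terms of the union coincide.
  \<open>binary_quadratic\<close> asks for generators in the carrier type of the operad itself,
  whereas the presentation defining \<open>As\<close> has generators in the type of the poset; an
  injective relabelling and an isomorphism of presented operads bridge the two. Morphisms are
  extensional, so agreement on the components is literal equality, as the definite description in
  \<open>As_map\<close> requires.\<close>

lemma linear_mapI:
  assumes "\<And>x. x \<in> carrier M \<Longrightarrow> f x \<in> carrier N"
    and "\<And>x y. x \<in> carrier M \<Longrightarrow> y \<in> carrier M \<Longrightarrow> f (x \<oplus>\<^bsub>M\<^esub> y) = f x \<oplus>\<^bsub>N\<^esub> f y"
    and "\<And>c x. c \<in> carrier K \<Longrightarrow> x \<in> carrier M \<Longrightarrow> f (c \<odot>\<^bsub>M\<^esub> x) = c \<odot>\<^bsub>N\<^esub> f x"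
  shows "linear_map K M N f"
  using assms unfolding linear_map_def by auto

lemma linear_map_closed: "linear_map K M N f \<Longrightarrow> x \<in> carrier M \<Longrightarrow> f x \<in> carrier N"
  unfolding linear_map_def by auto

lemma linear_map_add:
  "linear_map K M N f \<Longrightarrow> x \<in> carrier M \<Longrightarrow> y \<in> carrier M
    \<Longrightarrow> f (x \<oplus>\<^bsub>M\<^esub> y) = f x \<oplus>\<^bsub>N\<^esub> f y"
  unfolding linear_map_def by auto

lemma linear_map_smult:
  "linear_map K M N f \<Longrightarrow> c \<in> carrier K \<Longrightarrow> x \<in> carrier M \<Longrightarrow> f (c \<odot>\<^bsub>M\<^esub> x) = c \<odot>\<^bsub>N\<^esub> f x"
  unfolding linear_map_def by auto

lemma linear_map_compose:
  assumes f: "linear_map K M N f" and g: "linear_map K N L g"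
  shows "linear_map K M L (\<lambda>x. g (f x))"
proof (rule linear_mapI)
  note fg = linear_map_closed[OF f] linear_map_closed[OF g]
  show "g (f x) \<in> carrier L" if "x \<in> carrier M" for x
    using that fg by simp
  show "g (f (x \<oplus>\<^bsub>M\<^esub> y)) = g (f x) \<oplus>\<^bsub>L\<^esub> g (f y)" if "x \<in> carrier M" "y \<in> carrier M" for x y
    using that fg by (simp add: linear_map_add[OF f] linear_map_add[OF g])
  show "g (f (c \<odot>\<^bsub>M\<^esub> x)) = c \<odot>\<^bsub>L\<^esub> g (f x)" if "c \<in> carrier K" "x \<in> carrier M" for c x
    using that fg by (simp add: linear_map_smult[OF f] linear_map_smult[OF g])
qed

text \<open>Sums and multiples must stay in the carrier, the only place where the two maps are known
  to agree; hence the source is required to be a module. The use is to pass from a map to its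
  restriction.\<close>

lemma linear_map_cong:
  assumes f: "linear_map K M N f" and "module K M" and fg: "\<And>x. x \<in> carrier M \<Longrightarrow> f x = g x"
  shows "linear_map K M N g"
proof -
  interpret module K M by fact
  show ?thesis
  proof (rule linear_mapI)
    show "g x \<in> carrier N" if "x \<in> carrier M" for x
      using that fg linear_map_closed[OF f] by metis
    show "g (x \<oplus>\<^bsub>M\<^esub> y) = g x \<oplus>\<^bsub>N\<^esub> g y" if "x \<in> carrier M" "y \<in> carrier M" for x y
      using that fg linear_map_add[OF f] by (metis M.a_closed)
    show "g (c \<odot>\<^bsub>M\<^esub> x) = c \<odot>\<^bsub>N\<^esub> g x" if "c \<in> carrier K" "x \<in> carrier M" for c x
      using that fg linear_map_smult[OF f] by (metis smult_closed)
  qed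
qed

context
  fixes K :: "('k, 'r) ring_scheme" and M :: "('k, 'x) module" and N :: "('k, 'y) module" and f
  assumes modules: "module K M" "module K N" and linear: "linear_map K M N f"
begin

interpretation M: module K M by (rule modules)
interpretation N: module K N by (rule modules)

lemma linear_map_zero: "f \<zero>\<^bsub>M\<^esub> = \<zero>\<^bsub>N\<^esub>"
proof -
  have "f (\<zero>\<^bsub>K\<^esub> \<odot>\<^bsub>M\<^esub> \<zero>\<^bsub>M\<^esub>) = \<zero>\<^bsub>K\<^esub> \<odot>\<^bsub>N\<^esub> f \<zero>\<^bsub>M\<^esub>"
    by (rule linear_map_smult[OF linear]) auto
  then show ?thesis
    using linear_map_closed[OF linear] by simp
qed

lemma linear_map_a_inv:
  assumes "x \<in> carrier M"
  shows "f (\<ominus>\<^bsub>M\<^esub> x) = \<ominus>\<^bsub>N\<^esub> f x"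
proof -
  have "f (\<ominus>\<^bsub>M\<^esub> x) = f ((\<ominus>\<^bsub>K\<^esub> \<one>\<^bsub>K\<^esub>) \<odot>\<^bsub>M\<^esub> x)"
    using assms by (simp add: M.smult_l_minus)
  also have "\<dots> = \<ominus>\<^bsub>N\<^esub> f x"
    using assms linear_map_closed[OF linear]
    by (simp add: linear_map_smult[OF linear] N.smult_l_minus)
  finally show ?thesis .
qed

lemma linear_map_minus:
  assumes "x \<in> carrier M" and "y \<in> carrier M"
  shows "f (x \<ominus>\<^bsub>M\<^esub> y) = f x \<ominus>\<^bsub>N\<^esub> f y"
  using assms by (simp add: a_minus_def linear_map_add[OF linear] linear_map_a_inv)

text \<open>Arity by arity, this makes the preimage of an operad ideal an ideal.\<close>

lemma submodule_preimage:
  assumes "submodule H K N"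
  shows "submodule {x \<in> carrier M. f x \<in> H} K M"
  using N.submoduleE[OF assms] linear_map_add[OF linear] linear_map_smult[OF linear]
    submodule.axioms(1)[OF assms, THEN subgroup.one_closed]
  by (intro M.submoduleI) (auto simp: linear_map_zero linear_map_a_inv)

text \<open>Serves to carry the space of relations of a presentation along a relabelling of the
  generators.\<close>

lemma submodule_image:
  assumes "submodule H K M"
  shows "submodule (f ` H) K N"
proof (rule N.submoduleI)
  note H = M.submoduleE[OF assms]
  show "f ` H \<subseteq> carrier N"
    using H(1) linear_map_closed[OF linear] by auto
  show "\<zero>\<^bsub>N\<^esub> \<in> f ` H"
    using submodule.axioms(1)[OF assms, THEN subgroup.one_closed] linear_map_zero by force
  show "\<ominus>\<^bsub>N\<^esub> a \<in> f ` H" if "a \<in> f ` H" for a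
    using that H(1,3) linear_map_a_inv by (smt (verit) image_iff subsetD)
  show "a \<oplus>\<^bsub>N\<^esub> b \<in> f ` H" if "a \<in> f ` H" "b \<in> f ` H" for a b
    using that H(1,5) linear_map_add[OF linear] by (smt (verit) image_iff subsetD)
  show "c \<odot>\<^bsub>N\<^esub> a \<in> f ` H" if "c \<in> carrier K" "a \<in> f ` H" for c a
    using that H(1,4) linear_map_smult[OF linear] by (smt (verit) image_iff subsetD)
qed

end

section \<open>Intersections of submodules and linear spans\<close>

lemma submodule_Inter:
  assumes "module K M" and sub: "\<And>H. H \<in> \<H> \<Longrightarrow> submodule H K M" and "\<H> \<noteq> {}"
  shows "submodule (\<Inter>\<H>) K M"
proof -
  interpret module K M by fact
  show ?thesis
  proof (rule submoduleI)
    \<comment> \<open>The empty intersection would be the whole type, hence the assumption that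
      \<open>\<H>\<close> is nonempty.\<close>
    show "\<Inter>\<H> \<subseteq> carrier M"
      using submoduleE(1)[OF sub] assms(3) by blast
    show "\<zero>\<^bsub>M\<^esub> \<in> \<Inter>\<H>"
      using submodule.axioms(1)[OF sub, THEN subgroup.one_closed] by auto
    show "\<ominus>\<^bsub>M\<^esub> a \<in> \<Inter>\<H>" if "a \<in> \<Inter>\<H>" for a
      using that submoduleE(3)[OF sub] by auto
    show "a \<oplus>\<^bsub>M\<^esub> b \<in> \<Inter>\<H>" if "a \<in> \<Inter>\<H>" "b \<in> \<Inter>\<H>" for a b
      using that submoduleE(5)[OF sub] by auto
    show "c \<odot>\<^bsub>M\<^esub> a \<in> \<Inter>\<H>" if "c \<in> carrier K" "a \<in> \<Inter>\<H>" for c a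
      using that submoduleE(4)[OF sub] by auto
  qed
qed

lemma linear_span_submodule:
  assumes "module K M" and "S \<subseteq> carrier M"
  shows "submodule (linear_span K M S) K M"
  unfolding linear_span_def
  using assms module.carrier_is_submodule by (intro submodule_Inter) blast+

lemma linear_span_superset: "S \<subseteq> linear_span K M S"
  unfolding linear_span_def by auto

lemma linear_span_least: "submodule H K M \<Longrightarrow> S \<subseteq> H \<Longrightarrow> linear_span K M S \<subseteq> H"
  unfolding linear_span_def by auto

section \<open>Quotients of modules\<close>

context
  fixes K :: "('k, 'r) ring_scheme" and M :: "('k, 'x) module" and N
  assumes module: "module K M" and submodule: "submodule N K M"
begin

interpretation module K M by (rule module)
interpretation abelian_subgroup N M
  by (intro abelian_subgroupI3 additive_subgroupI submodule.axioms(1)[OF submodule])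
    (rule M.abelian_group_axioms)

lemma coset_shift:
  assumes "h \<in> N" and "x \<in> carrier M"
  shows "N +>\<^bsub>M\<^esub> (h \<oplus>\<^bsub>M\<^esub> x) = N +>\<^bsub>M\<^esub> x"
  using a_coset_add_assoc[OF a_subset, of h x] a_rcos_const[OF assms(1)] assms by simp

text \<open>Scalar multiples and partial compositions in a quotient are unions over representatives.
  Once the terms agree on a coset, the union collapses to their common value, because a coset has at
  least one element.\<close>

lemma UN_coset:
  assumes "x \<in> carrier M" and "\<And>h. h \<in> N \<Longrightarrow> f (h \<oplus>\<^bsub>M\<^esub> x) = v"
  shows "(\<Union>y\<in>N +>\<^bsub>M\<^esub> x. f y) = v"
proof -
  have "(\<Union>y\<in>N +>\<^bsub>M\<^esub> x. f y) = (\<Union>h\<in>N. f (h \<oplus>\<^bsub>M\<^esub> x))"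
    by (simp add: a_r_coset_def')
  also have "\<dots> = (\<Union>h\<in>N. v)"
    using assms(2) by simp
  finally show ?thesis
    using submoduleE(2)[OF submodule] by simp
qed

lemma quotient_carrier_iff:
  "X \<in> carrier (quotient_module M N) \<longleftrightarrow> (\<exists>x\<in>carrier M. X = N +>\<^bsub>M\<^esub> x)"
  by (auto simp: quotient_module_def A_RCOSETS_def')

lemma quotient_carrierE:
  assumes "X \<in> carrier (quotient_module M N)"
  obtains x where "x \<in> carrier M" and "X = N +>\<^bsub>M\<^esub> x"
  using assms by (auto simp: quotient_carrier_iff)

lemma quotient_add:
  "x \<in> carrier M \<Longrightarrow> y \<in> carrier M
    \<Longrightarrow> (N +>\<^bsub>M\<^esub> x) \<oplus>\<^bsub>quotient_module M N\<^esub> (N +>\<^bsub>M\<^esub> y) = N +>\<^bsub>M\<^esub> (x \<oplus>\<^bsub>M\<^esub> y)"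
  by (simp add: quotient_module_def a_rcos_sum)

lemma quotient_smult:
  assumes "c \<in> carrier K" and "x \<in> carrier M"
  shows "c \<odot>\<^bsub>quotient_module M N\<^esub> (N +>\<^bsub>M\<^esub> x) = N +>\<^bsub>M\<^esub> (c \<odot>\<^bsub>M\<^esub> x)"
proof -
  have "(\<Union>y\<in>N +>\<^bsub>M\<^esub> x. N +>\<^bsub>M\<^esub> (c \<odot>\<^bsub>M\<^esub> y)) = N +>\<^bsub>M\<^esub> (c \<odot>\<^bsub>M\<^esub> x)"
  proof (rule UN_coset[OF assms(2)])
    fix h assume "h \<in> N"
    then show "N +>\<^bsub>M\<^esub> (c \<odot>\<^bsub>M\<^esub> (h \<oplus>\<^bsub>M\<^esub> x)) = N +>\<^bsub>M\<^esub> (c \<odot>\<^bsub>M\<^esub> x)"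
      using assms submodule.smult_closed[OF submodule]
      by (simp add: smult_r_distr coset_shift)
  qed
  then show ?thesis
    by (simp add: quotient_module_def)
qed

lemma quotient_zero: "\<zero>\<^bsub>quotient_module M N\<^esub> = N +>\<^bsub>M\<^esub> \<zero>\<^bsub>M\<^esub>"
  using a_subset by (simp add: quotient_module_def)

lemma quotient_coset_closed: "x \<in> carrier M \<Longrightarrow> N +>\<^bsub>M\<^esub> x \<in> carrier (quotient_module M N)"
  by (auto simp: quotient_carrier_iff)

lemma coset_linear: "linear_map K M (quotient_module M N) (\<lambda>x. N +>\<^bsub>M\<^esub> x)"
  by (rule linear_mapI) (auto simp: quotient_add quotient_smult quotient_coset_closed)

lemma module_quotient: "module K (quotient_module M N)"
proof (rule moduleI)
  show "abelian_group (quotient_module M N)"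
  proof (rule abelian_groupI)
    fix X assume "X \<in> carrier (quotient_module M N)"
    then obtain x where x: "x \<in> carrier M" "X = N +>\<^bsub>M\<^esub> x"
      by (rule quotient_carrierE)
    then show "\<exists>Y\<in>carrier (quotient_module M N).
        Y \<oplus>\<^bsub>quotient_module M N\<^esub> X = \<zero>\<^bsub>quotient_module M N\<^esub>"
      by (intro bexI[of _ "N +>\<^bsub>M\<^esub> (\<ominus>\<^bsub>M\<^esub> x)"])
        (auto simp: quotient_add quotient_zero quotient_coset_closed M.l_neg)
  qed (auto elim!: quotient_carrierE
      simp: quotient_coset_closed quotient_add quotient_zero M.a_ac)
qed (auto elim!: quotient_carrierE intro: R.cring_axioms
    simp: quotient_coset_closed quotient_add quotient_smult smult_l_distr smult_r_distr smult_assoc1)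

end

text \<open>Only the values of \<open>g\<close> on cosets matter, so linearity descends from
  representatives. This covers both partial compositions in a quotient operad and maps induced
  between quotients.\<close>

lemma linear_map_quotientI:
  assumes "module K M" "submodule H K M" and "module K M'" "submodule H' K M'"
    and f: "linear_map K M M' f"
    and g: "\<And>x. x \<in> carrier M \<Longrightarrow> g (H +>\<^bsub>M\<^esub> x) = H' +>\<^bsub>M'\<^esub> f x"
  shows "linear_map K (quotient_module M H) (quotient_module M' H') g"
proof (rule linear_mapI)
  interpret module K M by fact
  note M = assms(1,2) and M' = assms(3,4)
  note simps = g linear_map_closed[OF f] quotient_add[OF M] quotient_add[OF M']
    quotient_smult[OF M] quotient_smult[OF M'] linear_map_add[OF f] linear_map_smult[OF f]
  fix X assume "X \<in> carrier (quotient_module M H)"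
  then obtain x where x: "x \<in> carrier M" "X = H +>\<^bsub>M\<^esub> x"
    by (rule quotient_carrierE[OF M])
  then show "g X \<in> carrier (quotient_module M' H')"
    using quotient_coset_closed[OF M'] by (simp add: simps)
  show "g (c \<odot>\<^bsub>quotient_module M H\<^esub> X) = c \<odot>\<^bsub>quotient_module M' H'\<^esub> g X"
    if "c \<in> carrier K" for c
    using that x by (simp add: simps)
  fix Y assume "Y \<in> carrier (quotient_module M H)"
  then obtain y where "y \<in> carrier M" "Y = H +>\<^bsub>M\<^esub> y"
    by (rule quotient_carrierE[OF M])
  then show "g (X \<oplus>\<^bsub>quotient_module M H\<^esub> Y) = g X \<oplus>\<^bsub>quotient_module M' H'\<^esub> g Y"
    using x by (simp add: simps)
qed

section \<open>Operad morphisms, ideals and quotients\<close>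

lemma (in ns_operad) circ_closed:
  "\<lbrakk>1 \<le> i; i \<le> n; x \<in> elems P n; y \<in> elems P m\<rbrakk> \<Longrightarrow> circ P n m i x y \<in> elems P (n + m - 1)"
  using circ_linear_left linear_map_closed by fastforce

lemma operad_homD:
  assumes "F \<in> operad_hom K P P'"
  shows operad_hom_extensional: "F n \<in> extensional (elems P n)"
    and operad_hom_linear: "linear_map K (space P n) (space P' n) (F n)"
    and operad_hom_unit: "F 1 (operad_unit P) = operad_unit P'"
    and operad_hom_circ:
      "\<lbrakk>1 \<le> i; i \<le> n; x \<in> elems P n; y \<in> elems P m\<rbrakk>
        \<Longrightarrow> F (n + m - 1) (circ P n m i x y) = circ P' n m i (F n x) (F m y)"
  using assms unfolding operad_hom_def by auto

lemma operad_hom_closed: "F \<in> operad_hom K P P' \<Longrightarrow> x \<in> elems P n \<Longrightarrow> F n x \<in> elems P' n"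
  using operad_hom_linear linear_map_closed by metis

lemma operad_hom_funcset: "F \<in> operad_hom K P P' \<Longrightarrow> F n \<in> elems P n \<rightarrow> elems P' n"
  using operad_hom_closed by auto

text \<open>Members of \<open>operad_hom\<close> are undefined outside the carriers. The unit and
  all composites lie in the carriers, so the equations for \<open>f\<close> survive
  restriction.\<close>

lemma (in ns_operad) restrict_operad_homI:
  assumes "\<And>n. linear_map K (space P n) (space P' n) (f n)"
    and "f 1 (operad_unit P) = operad_unit P'"
    and "\<And>n m i x y. \<lbrakk>1 \<le> i; i \<le> n; x \<in> elems P n; y \<in> elems P m\<rbrakk>
          \<Longrightarrow> f (n + m - 1) (circ P n m i x y) = circ P' n m i (f n x) (f m y)"
  shows "(\<lambda>n. restrict (f n) (elems P n)) \<in> operad_hom K P P'"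
proof -
  have "linear_map K (space P n) (space P' n) (restrict (f n) (elems P n))" for n
    by (rule linear_map_cong[OF assms(1) vector_space]) simp
  then show ?thesis
    using assms(2,3) unit_in circ_closed by (auto simp: operad_hom_def)
qed

lemma (in ns_operad) operad_hom_ident: "(\<lambda>n. \<lambda>x\<in>elems P n. x) \<in> operad_hom K P P"
  by (rule restrict_operad_homI) (auto intro: linear_mapI)

lemma (in ns_operad) operad_hom_compose:
  assumes F: "F \<in> operad_hom K P P'" and G: "G \<in> operad_hom K P' P''"
  shows "(\<lambda>n. compose (elems P n) (G n) (F n)) \<in> operad_hom K P P''"
  unfolding compose_def
  \<comment> \<open>\<open>simplified\<close> gives the facts the form with \<open>Suc 0\<close> in
    place of 1 that the simplified goals have.\<close>
  by (rule restrict_operad_homI)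
    (auto intro: linear_map_compose operad_hom_linear[OF F] operad_hom_linear[OF G]
      simp: operad_hom_unit[OF F, simplified] operad_hom_unit[OF G, simplified]
        operad_hom_circ[OF F, simplified] operad_hom_circ[OF G, simplified]
        operad_hom_closed[OF F])

lemma operad_hom_eqI:
  assumes "F \<in> operad_hom K P P'" and "G \<in> operad_hom K P P'"
    and "\<And>n x. x \<in> elems P n \<Longrightarrow> F n x = G n x"
  shows "F = G"
proof
  fix n
  show "F n = G n"
    by (rule extensionalityI[OF operad_hom_extensional[OF assms(1)]
          operad_hom_extensional[OF assms(2)]]) (rule assms(3))
qed

section \<open>Operad ideals and the ideal generated by a family\<close>

lemma operad_idealD:
  assumes "operad_ideal K P I"
  shows ideal_submodule: "submodule (I n) K (space P n)"
    and ideal_circ_left: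
      "\<lbrakk>1 \<le> i; i \<le> n; x \<in> I n; y \<in> elems P m\<rbrakk> \<Longrightarrow> circ P n m i x y \<in> I (n + m - 1)"
    and ideal_circ_right:
      "\<lbrakk>1 \<le> i; i \<le> n; x \<in> elems P n; y \<in> I m\<rbrakk> \<Longrightarrow> circ P n m i x y \<in> I (n + m - 1)"
  using assms unfolding operad_ideal_def by auto

lemma generated_ideal_superset: "R n \<subseteq> generated_ideal K P R n"
  unfolding generated_ideal_def by blast

lemma generated_idealI:
  "(\<And>I. operad_ideal K P I \<Longrightarrow> (\<And>m. R m \<subseteq> I m) \<Longrightarrow> x \<in> I n) \<Longrightarrow> x \<in> generated_ideal K P R n"
  unfolding generated_ideal_def by blast

lemma generated_ideal_least:
  "operad_ideal K P I \<Longrightarrow> (\<And>m. R m \<subseteq> I m) \<Longrightarrow> generated_ideal K P R n \<subseteq> I n"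
  unfolding generated_ideal_def by blast

text \<open>Provided the relations lie in the operad, this ideal makes the family intersected in
  \<open>generated_ideal\<close> nonempty.\<close>

lemma (in ns_operad) operad_ideal_elems: "operad_ideal K P (elems P)"
  unfolding operad_ideal_def
  using circ_closed module.carrier_is_submodule[OF vector_space] by auto

lemma (in ns_operad) generated_ideal_ideal:
  assumes "\<And>n. R n \<subseteq> elems P n"
  shows "operad_ideal K P (generated_ideal K P R)"
  unfolding operad_ideal_def
proof (intro conjI allI impI ballI)
  fix n
  show "submodule (generated_ideal K P R n) K (space P n)"
    unfolding generated_ideal_def
    using operad_ideal_elems assms ideal_submodule
    by (intro submodule_Inter[OF vector_space]) blast+
next
  fix n m i :: nat and x y assume i: "1 \<le> i \<and> i \<le> n"
  show "circ P n m i x y \<in> generated_ideal K P R (n + m - 1)"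
    if "x \<in> generated_ideal K P R n" "y \<in> elems P m"
  proof (rule generated_idealI)
    fix I assume I: "operad_ideal K P I" "\<And>m. R m \<subseteq> I m"
    have "x \<in> I n"
      using generated_ideal_least[OF I] that(1) by blast
    then show "circ P n m i x y \<in> I (n + m - 1)"
      using ideal_circ_left[OF I(1)] i that(2) by blast
  qed
  show "circ P n m i x y \<in> generated_ideal K P R (n + m - 1)"
    if "x \<in> elems P n" "y \<in> generated_ideal K P R m"
  proof (rule generated_idealI)
    fix I assume I: "operad_ideal K P I" "\<And>m. R m \<subseteq> I m"
    have "y \<in> I m"
      using generated_ideal_least[OF I] that(2) by blast
    then show "circ P n m i x y \<in> I (n + m - 1)"
      using ideal_circ_right[OF I(1)] i that(1) by blast
  qed
qed

lemma (in ns_operad) preimage_ideal: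
  assumes "ns_operad K P'" and F: "F \<in> operad_hom K P P'" and I: "operad_ideal K P' I"
  shows "operad_ideal K P (\<lambda>n. {x \<in> elems P n. F n x \<in> I n})"
proof -
  interpret P': ns_operad K P' by fact
  show ?thesis
    unfolding operad_ideal_def
    using submodule_preimage[OF vector_space P'.vector_space operad_hom_linear[OF F]
        ideal_submodule[OF I]]
    by (auto simp: circ_closed[simplified] operad_hom_circ[OF F, simplified]
        operad_hom_closed[OF F] ideal_circ_left[OF I, simplified]
        ideal_circ_right[OF I, simplified])
qed

text \<open>The elements sent into \<open>I\<close> form an ideal; as it contains \<open>R\<close>,
  it contains the ideal generated by \<open>R\<close>. This is how morphisms are shown to descend to
  quotients.\<close>

lemma (in ns_operad) generated_ideal_hom:
  assumes "ns_operad K P'" and F: "F \<in> operad_hom K P P'" and I: "operad_ideal K P' I"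
    and "\<And>n x. x \<in> R n \<Longrightarrow> x \<in> elems P n \<and> F n x \<in> I n"
    and "x \<in> generated_ideal K P R n"
  shows "F n x \<in> I n"
  using generated_ideal_least[OF preimage_ideal[OF assms(1-3)], of R n] assms(4,5) by auto

section \<open>Quotient of an operad by an ideal\<close>

context ns_operad
begin

context
  fixes I assumes ideal: "operad_ideal K P I"
begin

lemmas coset_facts = vector_space ideal_submodule[OF ideal]

lemma ideal_subset: "x \<in> I n \<Longrightarrow> x \<in> elems P n"
  using module.submoduleE(1)[OF coset_facts] by auto

lemma space_quotient: "space (quotient_operad P I) n = quotient_module (space P n) (I n)"
  by (simp add: quotient_operad_def)

lemma unit_quotient: "operad_unit (quotient_operad P I) = I 1 +>\<^bsub>space P 1\<^esub> operad_unit P"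
  by (simp add: quotient_operad_def)

text \<open>Shifting the arguments by elements of the ideal adds, by bilinearity, only composites
  with a factor in the ideal, and these vanish in the quotient.\<close>

lemma circ_quotient:
  assumes i: "1 \<le> i" "i \<le> n" and x: "x \<in> elems P n" and y: "y \<in> elems P m"
  shows "circ (quotient_operad P I) n m i (I n +>\<^bsub>space P n\<^esub> x) (I m +>\<^bsub>space P m\<^esub> y)
    = I (n + m - 1) +>\<^bsub>space P (n + m - 1)\<^esub> circ P n m i x y"
proof -
  let ?k = "n + m - 1"
  interpret n: module K "space P n" by (rule vector_space)
  interpret m: module K "space P m" by (rule vector_space)
  interpret k: module K "space P ?k" by (rule vector_space)
  have "I ?k +>\<^bsub>space P ?k\<^esub> circ P n m i (h \<oplus>\<^bsub>space P n\<^esub> x) (h' \<oplus>\<^bsub>space P m\<^esub> y)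
      = I ?k +>\<^bsub>space P ?k\<^esub> circ P n m i x y" if h: "h \<in> I n" "h' \<in> I m" for h h'
  proof -
    let ?y = "h' \<oplus>\<^bsub>space P m\<^esub> y"
    have y': "?y \<in> elems P m"
      using h y ideal_subset by simp
    have "circ P n m i (h \<oplus>\<^bsub>space P n\<^esub> x) ?y
        = circ P n m i h ?y \<oplus>\<^bsub>space P ?k\<^esub> (circ P n m i x h' \<oplus>\<^bsub>space P ?k\<^esub> circ P n m i x y)"
      unfolding linear_map_add[OF circ_linear_left[OF i y'] ideal_subset[OF h(1)] x]
        linear_map_add[OF circ_linear_right[OF i x] ideal_subset[OF h(2)] y] ..
    moreover have "circ P n m i h ?y \<in> I ?k" "circ P n m i x h' \<in> I ?k"
      using ideal_circ_left[OF ideal i h(1) y'] ideal_circ_right[OF ideal i x h(2)] by auto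
    ultimately show ?thesis
      using circ_closed[OF i x y]
      \<comment> \<open>Keeping \<open>1\<close> unexpanded preserves the arity expression
        \<open>n + m - 1\<close> in which the facts are stated.\<close>
      by (simp add: coset_shift[OF coset_facts] ideal_subset del: One_nat_def)
  qed
  then show ?thesis
    by (simp add: quotient_operad_def UN_coset[OF coset_facts x] UN_coset[OF coset_facts y])
qed

text \<open>The projection is packaged as a morphism so that it can be followed by morphisms out of
  the quotient.\<close>

lemma coset_hom:
  "(\<lambda>n. \<lambda>x\<in>elems P n. I n +>\<^bsub>space P n\<^esub> x) \<in> operad_hom K P (quotient_operad P I)"
  by (rule restrict_operad_homI)
    (simp_all add: unit_quotient circ_quotient[simplified] space_quotient
      coset_linear[OF coset_facts])

lemma quotient_elemsE:
  assumes "X \<in> elems (quotient_operad P I) n"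
  obtains x where "x \<in> elems P n" and "X = I n +>\<^bsub>space P n\<^esub> x"
  using assms by (auto simp: space_quotient quotient_carrier_iff[OF coset_facts])

lemma quotient_elemsI:
  "x \<in> elems P n \<Longrightarrow> I n +>\<^bsub>space P n\<^esub> x \<in> elems (quotient_operad P I) n"
  by (auto simp: space_quotient quotient_carrier_iff[OF coset_facts])

text \<open>Each axiom is inherited through representatives. The delicate part is arithmetic: the
  two sides of an associativity law live in components indexed by different expressions for the same
  arity.\<close>

lemma ns_operad_quotient: "ns_operad K (quotient_operad P I)"
proof (rule ns_operad.intro)
  fix n m p i j k and X Y Z
  let ?Q = "quotient_operad P I"
  show "field K" by (rule base_field)
  show "module K (space ?Q n)"
    by (simp add: space_quotient module_quotient[OF coset_facts])
  show "operad_unit ?Q \<in> elems ?Q 1"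
    using quotient_elemsI[OF unit_in] by (simp add: unit_quotient)
  {
    assume i: "1 \<le> i" "i \<le> n" and "Y \<in> elems ?Q m"
    from this(3) obtain y where y: "y \<in> elems P m" "Y = I m +>\<^bsub>space P m\<^esub> y"
      by (rule quotient_elemsE)
    have "linear_map K (space P n) (space P (n + m - 1)) (\<lambda>x. circ P n m i x y)"
      by (rule circ_linear_left[OF i y(1)])
    then show "linear_map K (space ?Q n) (space ?Q (n + m - 1)) (\<lambda>X. circ ?Q n m i X Y)"
      unfolding space_quotient
      by (rule linear_map_quotientI[OF coset_facts coset_facts])
        (simp add: y circ_quotient[OF i])
  }
  {
    assume i: "1 \<le> i" "i \<le> n" and "X \<in> elems ?Q n"
    from this(3) obtain x where x: "x \<in> elems P n" "X = I n +>\<^bsub>space P n\<^esub> x"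
      by (rule quotient_elemsE)
    have "linear_map K (space P m) (space P (n + m - 1)) (\<lambda>y. circ P n m i x y)"
      by (rule circ_linear_right[OF i x(1)])
    then show "linear_map K (space ?Q m) (space ?Q (n + m - 1)) (\<lambda>Y. circ ?Q n m i X Y)"
      unfolding space_quotient
      by (rule linear_map_quotientI[OF coset_facts coset_facts])
        (simp add: x circ_quotient[OF i])
  }
  show "X \<in> elems ?Q n \<Longrightarrow> circ ?Q 1 n 1 (operad_unit ?Q) X = X"
    using circ_quotient[of 1 1 "operad_unit P" _ n] unit_in
    by (auto elim!: quotient_elemsE simp: unit_quotient unit_left[simplified])
  show "\<lbrakk>1 \<le> i; i \<le> n; X \<in> elems ?Q n\<rbrakk> \<Longrightarrow> circ ?Q n 1 i X (operad_unit ?Q) = X"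
    using circ_quotient[of i n _ "operad_unit P" 1] unit_in
    by (auto elim!: quotient_elemsE simp: unit_quotient unit_right[simplified])
  show "circ ?Q (n + m - 1) p (i + j - 1) (circ ?Q n m i X Y) Z
      = circ ?Q n (m + p - 1) i X (circ ?Q m p j Y Z)"
    if "1 \<le> i" "i \<le> n" "1 \<le> j" "j \<le> m" "X \<in> elems ?Q n" "Y \<in> elems ?Q m" "Z \<in> elems ?Q p"
  proof -
    note prems = that
    obtain x y z where x: "x \<in> elems P n" "X = I n +>\<^bsub>space P n\<^esub> x"
      and y: "y \<in> elems P m" "Y = I m +>\<^bsub>space P m\<^esub> y"
      and z: "z \<in> elems P p" "Z = I p +>\<^bsub>space P p\<^esub> z"
      using prems(5-7) by (metis quotient_elemsE)
    \<comment> \<open>The truncated subtractions agree because \<open>1 \<le> j\<close> and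
      \<open>j \<le> m\<close> make \<open>m\<close> positive.\<close>
    have *: "1 \<le> i + j - 1" "i + j - 1 \<le> n + m - 1" "n + m - 1 + p - 1 = n + (m + p - 1) - 1"
      using that(1-4) by auto
    note closed = circ_closed[OF that(1,2) x(1) y(1)] circ_closed[OF that(3,4) y(1) z(1)]
    show ?thesis
      using assoc_sequential[OF that(1-4) x(1) y(1) z(1)]
      unfolding x(2) y(2) z(2) circ_quotient[OF that(1,2) x(1) y(1)]
        circ_quotient[OF that(3,4) y(1) z(1)] circ_quotient[OF *(1,2) closed(1) z(1)]
        circ_quotient[OF that(1,2) x(1) closed(2)] *(3)
      by simp
  qed
  show "circ ?Q (n + m - 1) p (k + m - 1) (circ ?Q n m i X Y) Z
      = circ ?Q (n + p - 1) m i (circ ?Q n p k X Z) Y"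
    if "1 \<le> i" "i < k" "k \<le> n" "X \<in> elems ?Q n" "Y \<in> elems ?Q m" "Z \<in> elems ?Q p"
  proof -
    note prems = that
    obtain x y z where x: "x \<in> elems P n" "X = I n +>\<^bsub>space P n\<^esub> x"
      and y: "y \<in> elems P m" "Y = I m +>\<^bsub>space P m\<^esub> y"
      and z: "z \<in> elems P p" "Z = I p +>\<^bsub>space P p\<^esub> z"
      using prems(4-6) by (metis quotient_elemsE)
    \<comment> \<open>The two inserted elements may have arity 0. Since \<open>i < k\<close> makes
      \<open>k\<close>, and thus \<open>n\<close>, at least 2, the positions stay in range and the
      truncated subtractions agree.\<close>
    have *: "1 \<le> k + m - 1" "k + m - 1 \<le> n + m - 1" "i \<le> n" "1 \<le> k" "i \<le> n + p - 1"
        "n + m - 1 + p - 1 = n + p - 1 + m - 1"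
      using that(1-3) by auto
    note closed = circ_closed[OF that(1) *(3) x(1) y(1)] circ_closed[OF *(4) that(3) x(1) z(1)]
    show ?thesis
      using assoc_parallel[OF that(1-3) x(1) y(1) z(1)]
      unfolding x(2) y(2) z(2) circ_quotient[OF that(1) *(3) x(1) y(1)]
        circ_quotient[OF *(4) that(3) x(1) z(1)] circ_quotient[OF *(1,2) closed(1) z(1)]
        circ_quotient[OF that(1) *(5) closed(2) y(1)] *(6)
      by simp
  qed
qed

end

end

section \<open>Free modules\<close>

definition linear_extension ::
  "('k, 'r) ring_scheme \<Rightarrow> ('k, 'x) module \<Rightarrow> ('b \<Rightarrow> 'x) \<Rightarrow> ('b \<Rightarrow> 'k) \<Rightarrow> 'x" where
  "linear_extension K N h f = (\<Oplus>\<^bsub>N\<^esub>b\<in>{b. f b \<noteq> \<zero>\<^bsub>K\<^esub>}. f b \<odot>\<^bsub>N\<^esub> h b)"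

context cring
begin

lemma free_module_simps:
  "\<zero>\<^bsub>free_module R B\<^esub> = (\<lambda>b. \<zero>)"
  "f \<oplus>\<^bsub>free_module R B\<^esub> g = (\<lambda>b. f b \<oplus> g b)"
  "c \<odot>\<^bsub>free_module R B\<^esub> f = (\<lambda>b. c \<otimes> f b)"
  by (simp_all add: free_module_def)

lemma free_module_carrier_iff:
  "f \<in> carrier (free_module R B) \<longleftrightarrow>
    (\<forall>b. f b \<in> carrier R) \<and> finite {b. f b \<noteq> \<zero>} \<and> (\<forall>b. b \<notin> B \<longrightarrow> f b = \<zero>)"
  by (auto simp: free_module_def)

text \<open>A finite set covering the support is easier to provide than the support itself, which
  may shrink under addition and multiplication.\<close>

lemma free_module_carrierI:
  assumes "\<And>b. f b \<in> carrier R" and "finite A" and "A \<subseteq> B" and "\<And>b. b \<notin> A \<Longrightarrow> f b = \<zero>"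
  shows "f \<in> carrier (free_module R B)"
  using assms by (auto simp: free_module_carrier_iff intro: finite_subset[of _ A])

lemma free_module_carrierE:
  assumes "f \<in> carrier (free_module R B)"
  obtains A where "finite A" and "A \<subseteq> B" and "\<And>b. b \<notin> A \<Longrightarrow> f b = \<zero>"
  using assms by (intro that[of "{b. f b \<noteq> \<zero>}"]) (auto simp: free_module_carrier_iff)

lemma free_module_value: "f \<in> carrier (free_module R B) \<Longrightarrow> f b \<in> carrier R"
  by (simp add: free_module_carrier_iff)

lemma free_module_add_closed:
  assumes "f \<in> carrier (free_module R B)" and "g \<in> carrier (free_module R B)"
  shows "f \<oplus>\<^bsub>free_module R B\<^esub> g \<in> carrier (free_module R B)"
proof -
  obtain A where A: "finite A" "A \<subseteq> B" "\<And>b. b \<notin> A \<Longrightarrow> f b = \<zero>"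
    using assms(1) by (rule free_module_carrierE) blast
  obtain A' where A': "finite A'" "A' \<subseteq> B" "\<And>b. b \<notin> A' \<Longrightarrow> g b = \<zero>"
    using assms(2) by (rule free_module_carrierE) blast
  show ?thesis
    using A A' assms
    by (intro free_module_carrierI[of _ "A \<union> A'"]) (auto simp: free_module_simps free_module_value)
qed

lemma free_module_smult_closed:
  assumes "c \<in> carrier R" and "f \<in> carrier (free_module R B)"
  shows "c \<odot>\<^bsub>free_module R B\<^esub> f \<in> carrier (free_module R B)"
proof -
  obtain A where A: "finite A" "A \<subseteq> B" "\<And>b. b \<notin> A \<Longrightarrow> f b = \<zero>"
    using assms(2) by (rule free_module_carrierE) blast
  show ?thesis
    using A assms
    by (intro free_module_carrierI[of _ A]) (auto simp: free_module_simps free_module_value)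
qed

lemma module_free_module: "module R (free_module R B)"
proof (rule moduleI)
  show "abelian_group (free_module R B)"
  proof (rule abelian_groupI)
    fix f assume f: "f \<in> carrier (free_module R B)"
    \<comment> \<open>Minus one times \<open>f\<close> serves as the opposite of \<open>f\<close>;
      closure under multiples settles its support.\<close>
    have "\<ominus> \<one> \<odot>\<^bsub>free_module R B\<^esub> f \<in> carrier (free_module R B)"
      using f by (simp add: free_module_smult_closed)
    moreover have "(\<ominus> \<one> \<odot>\<^bsub>free_module R B\<^esub> f) \<oplus>\<^bsub>free_module R B\<^esub> f = \<zero>\<^bsub>free_module R B\<^esub>"
      using free_module_value[OF f] by (simp add: free_module_simps l_minus l_neg)
    ultimately show "\<exists>g\<in>carrier (free_module R B).
        g \<oplus>\<^bsub>free_module R B\<^esub> f = \<zero>\<^bsub>free_module R B\<^esub>"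
      by blast
  next
    show "\<zero>\<^bsub>free_module R B\<^esub> \<in> carrier (free_module R B)"
      by (simp add: free_module_simps free_module_carrier_iff)
    show "f \<oplus>\<^bsub>free_module R B\<^esub> g \<in> carrier (free_module R B)"
      if "f \<in> carrier (free_module R B)" "g \<in> carrier (free_module R B)" for f g
      using that by (rule free_module_add_closed)
  qed (auto simp: free_module_simps fun_eq_iff free_module_value intro!: a_assoc a_comm)
  show "a \<odot>\<^bsub>free_module R B\<^esub> f \<in> carrier (free_module R B)"
    if "a \<in> carrier R" "f \<in> carrier (free_module R B)" for a f
    using that by (rule free_module_smult_closed)
qed (auto intro: cring_axioms simp: free_module_simps fun_eq_iff
    free_module_value l_distr r_distr m_assoc)

lemma basis_elem_closed: "b \<in> B \<Longrightarrow> basis_elem R b \<in> carrier (free_module R B)"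
  by (rule free_module_carrierI[of _ "{b}"]) (auto simp: basis_elem_def)

text \<open>The induction runs over a finite set covering the support: an element is split into its
  term at one basis element and the rest.\<close>

lemma free_module_induct [consumes 1, case_names zero add]:
  assumes "f \<in> carrier (free_module R B)"
    and "P \<zero>\<^bsub>free_module R B\<^esub>"
    and add: "\<And>c b f. \<lbrakk>c \<in> carrier R; b \<in> B; f \<in> carrier (free_module R B); P f\<rbrakk>
      \<Longrightarrow> P ((c \<odot>\<^bsub>free_module R B\<^esub> basis_elem R b) \<oplus>\<^bsub>free_module R B\<^esub> f)"
  shows "P f"
proof -
  obtain A where "finite A" "A \<subseteq> B" "\<And>b. b \<notin> A \<Longrightarrow> f b = \<zero>"
    using assms(1) by (rule free_module_carrierE) blast
  then show ?thesis
    using assms(1)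
  proof (induction A arbitrary: f)
    case empty
    then have "f = \<zero>\<^bsub>free_module R B\<^esub>"
      by (auto simp: free_module_simps)
    then show ?case
      using assms(2) by simp
  next
    case (insert b A)
    let ?g = "f(b := \<zero>)"
    have val: "f c \<in> carrier R" for c
      using insert.prems by (simp add: free_module_value)
    have g: "?g \<in> carrier (free_module R B)"
      using insert val by (intro free_module_carrierI[of _ A]) auto
    moreover have "P ?g"
      using insert.hyps insert.prems g by (intro insert.IH) (auto simp del: fun_upd_apply, auto)
    ultimately have "P ((f b \<odot>\<^bsub>free_module R B\<^esub> basis_elem R b) \<oplus>\<^bsub>free_module R B\<^esub> ?g)"
      using insert.prems val by (intro add) auto
    also have "(f b \<odot>\<^bsub>free_module R B\<^esub> basis_elem R b) \<oplus>\<^bsub>free_module R B\<^esub> ?g = f"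
      using val by (auto simp: free_module_simps basis_elem_def)
    finally show ?case .
  qed
qed

lemma linear_map_free_eqI:
  assumes "module R N" and f: "linear_map R (free_module R B) N f"
    and g: "linear_map R (free_module R B) N g"
    and "\<And>b. b \<in> B \<Longrightarrow> f (basis_elem R b) = g (basis_elem R b)"
    and "x \<in> carrier (free_module R B)"
  shows "f x = g x"
  using assms(5)
proof (induction rule: free_module_induct)
  case zero
  then show ?case
    using linear_map_zero[OF module_free_module assms(1)] f g by metis
next
  case (add c b x)
  then show ?case
    using assms(4) by (simp add: free_module_smult_closed basis_elem_closed
        linear_map_add[OF f] linear_map_add[OF g] linear_map_smult[OF f] linear_map_smult[OF g])
qed

context
  fixes N :: "('a, 'x) module" and B and h :: "'c \<Rightarrow> 'x"
  assumes target: "module R N" and h: "\<And>b. b \<in> B \<Longrightarrow> h b \<in> carrier N"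
begin

interpretation N: module R N by (rule target)

text \<open>The sum in \<open>linear_extension\<close> runs over the exact support. Enlarging it by
  zero terms gives two elements a common index set, on which additivity can be checked
  termwise.\<close>

lemma linear_extension_superset:
  assumes f: "f \<in> carrier (free_module R B)"
    and A: "finite A" "A \<subseteq> B" "\<And>b. b \<notin> A \<Longrightarrow> f b = \<zero>"
  shows "linear_extension R N h f = (\<Oplus>\<^bsub>N\<^esub>b\<in>A. f b \<odot>\<^bsub>N\<^esub> h b)"
  unfolding linear_extension_def
proof (rule N.add.finprod_mono_neutral_cong_left)
  show "f i \<odot>\<^bsub>N\<^esub> h i = \<zero>\<^bsub>N\<^esub>" if "i \<in> A - {b. f b \<noteq> \<zero>}" for i
    using that A(2) h by auto
  show "(\<lambda>b. f b \<odot>\<^bsub>N\<^esub> h b) \<in> A \<rightarrow> carrier N"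
    using A(2) h free_module_value[OF f] by auto
qed (use A in auto)

lemma linear_extension_linear: "linear_map R (free_module R B) N (linear_extension R N h)"
proof (rule linear_mapI)
  fix f assume f: "f \<in> carrier (free_module R B)"
  then obtain A where A: "finite A" "A \<subseteq> B" "\<And>b. b \<notin> A \<Longrightarrow> f b = \<zero>"
    by (rule free_module_carrierE) blast
  note val = free_module_value[OF f]
  have hA: "b \<in> A \<Longrightarrow> h b \<in> carrier N" for b
    using A(2) h by auto
  show "linear_extension R N h f \<in> carrier N"
    using hA val by (simp add: linear_extension_superset[OF f A] Pi_def N.finsum_closed)
  show "linear_extension R N h (c \<odot>\<^bsub>free_module R B\<^esub> f) = c \<odot>\<^bsub>N\<^esub> linear_extension R N h f"
    if c: "c \<in> carrier R" for c
  proof -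
    have "linear_extension R N h (c \<odot>\<^bsub>free_module R B\<^esub> f)
        = (\<Oplus>\<^bsub>N\<^esub>b\<in>A. (c \<odot>\<^bsub>free_module R B\<^esub> f) b \<odot>\<^bsub>N\<^esub> h b)"
      using A c by (intro linear_extension_superset free_module_smult_closed c f)
        (auto simp: free_module_simps)
    also have "\<dots> = (\<Oplus>\<^bsub>N\<^esub>b\<in>A. c \<odot>\<^bsub>N\<^esub> (f b \<odot>\<^bsub>N\<^esub> h b))"
      using c val hA by (intro N.add.finprod_cong') (auto simp: free_module_simps N.smult_assoc1)
    also have "\<dots> = c \<odot>\<^bsub>N\<^esub> (\<Oplus>\<^bsub>N\<^esub>b\<in>A. f b \<odot>\<^bsub>N\<^esub> h b)"
      using A c val hA by (intro N.finsum_smult_ldistr[symmetric]) auto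
    finally show ?thesis
      by (simp add: linear_extension_superset[OF f A])
  qed
  fix g assume g: "g \<in> carrier (free_module R B)"
  then obtain A' where A': "finite A'" "A' \<subseteq> B" "\<And>b. b \<notin> A' \<Longrightarrow> g b = \<zero>"
    by (rule free_module_carrierE) blast
  note val' = free_module_value[OF g]
  have h': "b \<in> A \<union> A' \<Longrightarrow> h b \<in> carrier N" for b
    using A(2) A'(2) h by auto
  have "linear_extension R N h (f \<oplus>\<^bsub>free_module R B\<^esub> g)
      = (\<Oplus>\<^bsub>N\<^esub>b\<in>A \<union> A'. (f \<oplus>\<^bsub>free_module R B\<^esub> g) b \<odot>\<^bsub>N\<^esub> h b)"
    using A A' by (intro linear_extension_superset free_module_add_closed f g)
      (auto simp: free_module_simps)
  also have "\<dots> = (\<Oplus>\<^bsub>N\<^esub>b\<in>A \<union> A'. f b \<odot>\<^bsub>N\<^esub> h b \<oplus>\<^bsub>N\<^esub> g b \<odot>\<^bsub>N\<^esub> h b)"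
    using val val' h' by (intro N.add.finprod_cong') (auto simp: free_module_simps N.smult_l_distr)
  also have "\<dots> = (\<Oplus>\<^bsub>N\<^esub>b\<in>A \<union> A'. f b \<odot>\<^bsub>N\<^esub> h b) \<oplus>\<^bsub>N\<^esub> (\<Oplus>\<^bsub>N\<^esub>b\<in>A \<union> A'. g b \<odot>\<^bsub>N\<^esub> h b)"
    using val val' h' by (intro N.finsum_addf) auto
  also have "(\<Oplus>\<^bsub>N\<^esub>b\<in>A \<union> A'. f b \<odot>\<^bsub>N\<^esub> h b) = linear_extension R N h f"
    using A A' by (intro linear_extension_superset[symmetric] f) auto
  also have "(\<Oplus>\<^bsub>N\<^esub>b\<in>A \<union> A'. g b \<odot>\<^bsub>N\<^esub> h b) = linear_extension R N h g"
    using A A' by (intro linear_extension_superset[symmetric] g) auto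
  finally show "linear_extension R N h (f \<oplus>\<^bsub>free_module R B\<^esub> g)
      = linear_extension R N h f \<oplus>\<^bsub>N\<^esub> linear_extension R N h g" .
qed

lemma linear_extension_basis:
  assumes "b \<in> B"
  shows "linear_extension R N h (basis_elem R b) = h b"
proof -
  have "linear_extension R N h (basis_elem R b) = (\<Oplus>\<^bsub>N\<^esub>c\<in>{b}. basis_elem R b c \<odot>\<^bsub>N\<^esub> h c)"
    using assms by (intro linear_extension_superset basis_elem_closed) (auto simp: basis_elem_def)
  then show ?thesis
    using assms h by (simp add: basis_elem_def)
qed

end

end

section \<open>Free operads on binary generators\<close>

lemma size1_graft:
  "1 \<le> i \<Longrightarrow> i \<le> size1 t \<Longrightarrow> size1 (graft t i u) = size1 t + size1 u - 1"
proof (induction t i u rule: graft.induct)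
  \<comment> \<open>Every tree has a leaf, so the subtraction of 1 in the arity never
    truncates.\<close>
  case (2 l a r i u)
  have "0 < size1 l" "0 < size1 r" "0 < size1 u"
    by simp_all
  with 2 show ?case
    by (cases "i \<le> size1 l") (auto simp del: size1_ge0)
qed simp

lemma set_tree_graft: "set_tree (graft t i u) \<subseteq> set_tree t \<union> set_tree u"
  by (induction t i u rule: graft.induct) auto

lemma map_tree_graft: "map_tree \<phi> (graft t i u) = graft (map_tree \<phi> t) i (map_tree \<phi> u)"
  by (induction t i u rule: graft.induct) auto

lemma graft_Leaf_right: "1 \<le> i \<Longrightarrow> i \<le> size1 t \<Longrightarrow> graft t i Leaf = t"
  by (induction t i "Leaf :: 'a tree" rule: graft.induct) auto

text \<open>Leaf \<open>j\<close> of \<open>u\<close> becomes leaf \<open>i + j - 1\<close> of the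
  graft. What has to be checked is that the comparison with the size of the left subtree, made by
  \<open>graft\<close> at each node, comes out alike on both sides.\<close>

lemma graft_graft_sequential:
  assumes "1 \<le> i" and "i \<le> size1 t" and "1 \<le> j" and "j \<le> size1 u"
  shows "graft (graft t i u) (i + j - 1) v = graft t i (graft u j v)"
  using assms
proof (induction t i u rule: graft.induct)
  case (2 l a r i u)
  show ?case
  proof (cases "i \<le> size1 l")
    case True
    with 2 have "i + j - 1 \<le> size1 (graft l i u)"
      by (simp add: size1_graft)
    with 2 True show ?thesis
      by simp
  next
    case False
    with 2 have "i - size1 l + j - 1 = i + j - 1 - size1 l" "\<not> i + j - 1 \<le> size1 l"
      by simp_all
    with 2 False show ?thesis
      by simp
  qed
qed simp

text \<open>Replacing leaf \<open>i\<close> by \<open>u\<close> moves every later leaf by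
  \<open>size1 u - 1\<close>. The root puts the two leaves both to its left, one on each side, or
  both to its right; the middle case is settled without induction, as the graftings take place in
  different subtrees.\<close>

lemma graft_graft_parallel:
  assumes "1 \<le> i" and "i < k" and "k \<le> size1 t"
  shows "graft (graft t i u) (k + size1 u - 1) v = graft (graft t k v) i u"
  using assms
proof (induction t arbitrary: i k)
  case (Node l a r)
  have pos: "size1 u \<ge> 1" "size1 v \<ge> 1"
    by (simp_all add: Suc_leI)
  consider "k \<le> size1 l" | "i \<le> size1 l" "size1 l < k" | "size1 l < i"
    by linarith
  then show ?case
  proof cases
    case 1
    with Node.prems pos have "k + size1 u - 1 \<le> size1 (graft l i u)" "i \<le> size1 (graft l k v)"
      by (simp_all add: size1_graft)
    with 1 Node.prems Node.IH(1)[of i k] show ?thesis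
      by simp
  next
    case 2
    with Node.prems pos have "k + size1 u - 1 - (size1 l + size1 u - 1) = k - size1 l"
      by simp
    moreover have "\<not> k + size1 u - 1 \<le> size1 (graft l i u)"
      using 2 Node.prems pos by (simp add: size1_graft)
    ultimately show ?thesis
      using 2 Node.prems by (simp add: size1_graft)
  next
    case 3
    with Node.prems pos have "k + size1 u - 1 - size1 l = k - size1 l + size1 u - 1"
        "\<not> k + size1 u - 1 \<le> size1 l"
      by simp_all
    with 3 Node.prems pos Node.IH(2)[of "i - size1 l" "k - size1 l"] show ?thesis
      by simp
  qed
qed simp

text \<open>The arities have to be fixed: \<open>graft Leaf 1 u\<close> and
  \<open>graft u 1 Leaf\<close> are the same tree. With equal arities, position \<open>i\<close>
  falls on the same side of both roots, and the subtrees are compared by induction. As a result, the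
  sum defining a composition coefficient has at most one term.\<close>

lemma graft_inject:
  assumes "graft t i u = graft t' i u'" and "size1 t = size1 t'" and "size1 u = size1 u'"
    and "1 \<le> i" and "i \<le> size1 t"
  shows "t = t' \<and> u = u'"
  using assms
proof (induction t arbitrary: t' i)
  case Leaf
  then have "t' = Leaf"
    by (cases t') (auto simp: size1_size)
  with Leaf show ?case
    by simp
next
  case (Node l a r)
  have pos: "size1 u \<ge> 1" "size1 u' \<ge> 1" "size1 l \<ge> 1" "size1 r \<ge> 1"
    by (simp_all add: Suc_leI)
  obtain l' a' r' where t': "t' = Node l' a' r'"
    using Node.prems(2) pos by (cases t') (auto simp: size1_size)
  show ?case
  proof (cases "i \<le> size1 l"; cases "i \<le> size1 l'")
    assume i: "i \<le> size1 l" "i \<le> size1 l'"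
    with Node.prems(1) t' have eq: "graft l i u = graft l' i u'" "a = a'" "r = r'"
      by auto
    with Node.prems have "size1 l = size1 l'"
      by (simp add: t')
    with Node.IH(1)[OF eq(1)] Node.prems i eq show ?thesis
      by (simp add: t')
  next
    \<comment> \<open>Grafting never removes leaves, so \<open>l'\<close> would have at least as
      many leaves as \<open>l\<close>, contradicting the two positions of \<open>i\<close>.\<close>
    assume i: "i \<le> size1 l" "\<not> i \<le> size1 l'"
    with Node.prems(1) t' have "graft l i u = l'"
      by auto
    with size1_graft[OF Node.prems(4) i(1), of u] have "size1 l' = size1 l + size1 u - 1"
      by simp
    with i pos(1) show ?thesis
      by linarith
  next
    assume i: "\<not> i \<le> size1 l" "i \<le> size1 l'"
    with Node.prems(1) t' have "l = graft l' i u'"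
      by auto
    with size1_graft[OF Node.prems(4) i(2), of u'] have "size1 l = size1 l' + size1 u' - 1"
      by simp
    with i pos(2) show ?thesis
      by linarith
  next
    assume i: "\<not> i \<le> size1 l" "\<not> i \<le> size1 l'"
    with Node.prems(1) t' have eq: "graft r (i - size1 l) u = graft r' (i - size1 l') u'"
        "a = a'" "l = l'"
      by auto
    with Node.IH(2)[of "i - size1 l" r'] Node.prems i show ?thesis
      by (simp add: t')
  qed
qed

lemma graft_in_syntax_trees:
  assumes "1 \<le> i" and "i \<le> n" and "t \<in> syntax_trees G n" and "u \<in> syntax_trees G m"
  shows "graft t i u \<in> syntax_trees G (n + m - 1)"
  using assms set_tree_graft[of t i u] by (auto simp: syntax_trees_def size1_graft)

lemma map_tree_in_syntax_trees:
  "\<phi> \<in> G \<rightarrow> H \<Longrightarrow> t \<in> syntax_trees G n \<Longrightarrow> map_tree \<phi> t \<in> syntax_trees H n"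
  by (auto simp: syntax_trees_def tree.set_map)

section \<open>Partial composition in the free operad\<close>

context cring
begin

context
  fixes G :: "'g set"
begin

abbreviation (input) "FG \<equiv> free_operad R G"

lemma free_operad_space: "space FG n = free_module R (syntax_trees G n)"
  by (simp add: free_operad_def)

lemma free_operad_unit: "operad_unit FG = basis_elem R Leaf"
  by (simp add: free_operad_def)

text \<open>By \<open>graft_inject\<close>, only the pair of \<open>t\<close> and \<open>u\<close>
  contributes to this coefficient.\<close>

lemma free_operad_circ_graft:
  assumes f: "f \<in> elems FG n" and g: "g \<in> elems FG m" and i: "1 \<le> i" "i \<le> n"
    and t: "t \<in> syntax_trees G n" "u \<in> syntax_trees G m"
  shows "circ FG n m i f g (graft t i u) = f t \<otimes> g u"
proof -
  have "p = (t, u)"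
    if "p \<in> syntax_trees G n \<times> syntax_trees G m" "graft (fst p) i (snd p) = graft t i u" for p
    using graft_inject[OF that(2)] that(1) t i by (auto simp: syntax_trees_def prod_eq_iff)
  then have "{p \<in> syntax_trees G n \<times> syntax_trees G m. graft (fst p) i (snd p) = graft t i u}
      = {(t, u)}"
    using t by auto
  then show ?thesis
    using f g by (simp add: free_operad_def free_module_value)
qed

lemma free_operad_circ_outside:
  assumes "\<And>t u. t \<in> syntax_trees G n \<Longrightarrow> u \<in> syntax_trees G m \<Longrightarrow> s \<noteq> graft t i u"
  shows "circ FG n m i f g s = \<zero>"
proof -
  have "{p \<in> syntax_trees G n \<times> syntax_trees G m. graft (fst p) i (snd p) = s} = {}"
    using assms by fastforce
  then show ?thesis
    by (simp only: free_operad_def operad.simps finsum_empty)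
qed

text \<open>A composite is determined by its coefficients at grafted trees; everywhere else its
  defining sum is empty.\<close>

lemma free_operad_circ_eqI:
  assumes "\<And>t u. t \<in> syntax_trees G n \<Longrightarrow> u \<in> syntax_trees G m
      \<Longrightarrow> circ FG n m i f g (graft t i u) = F (graft t i u)"
    and "\<And>s. (\<And>t u. t \<in> syntax_trees G n \<Longrightarrow> u \<in> syntax_trees G m \<Longrightarrow> s \<noteq> graft t i u)
      \<Longrightarrow> F s = \<zero>"
  shows "circ FG n m i f g = F"
proof
  fix s
  show "circ FG n m i f g s = F s"
  proof (cases "\<exists>t\<in>syntax_trees G n. \<exists>u\<in>syntax_trees G m. s = graft t i u")
    case False
    then show ?thesis
      using assms(2) free_operad_circ_outside[of n m s i f g] by metis
  qed (use assms(1) in auto)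
qed

lemma free_operad_circ_closed:
  assumes f: "f \<in> elems FG n" and g: "g \<in> elems FG m" and i: "1 \<le> i" "i \<le> n"
  shows "circ FG n m i f g \<in> elems FG (n + m - 1)"
proof -
  obtain A where A: "finite A" "A \<subseteq> syntax_trees G n" "\<And>b. b \<notin> A \<Longrightarrow> f b = \<zero>"
    using f[unfolded free_operad_space] by (rule free_module_carrierE) blast
  obtain B where B: "finite B" "B \<subseteq> syntax_trees G m" "\<And>b. b \<notin> B \<Longrightarrow> g b = \<zero>"
    using g[unfolded free_operad_space] by (rule free_module_carrierE) blast
  note val = free_module_value[OF f[unfolded free_operad_space]]
    free_module_value[OF g[unfolded free_operad_space]]
  \<comment> \<open>The grafts of trees from \<open>A\<close> and \<open>B\<close> form a finite set
    outside of which all coefficients vanish.\<close>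
  let ?C = "(\<lambda>(t, u). graft t i u) ` (A \<times> B)"
  show ?thesis
    unfolding free_operad_space
  proof (rule free_module_carrierI[of _ ?C])
    fix s
    consider t u where "t \<in> syntax_trees G n" "u \<in> syntax_trees G m" "s = graft t i u"
      | "\<And>t u. t \<in> syntax_trees G n \<Longrightarrow> u \<in> syntax_trees G m \<Longrightarrow> s \<noteq> graft t i u"
      by blast
    note cases = this
    then show "circ FG n m i f g s \<in> carrier R"
      using val by cases (auto simp: free_operad_circ_graft[OF f g i] free_operad_circ_outside)
    show "circ FG n m i f g s = \<zero>" if "s \<notin> ?C"
      using cases
    proof cases
      case (1 t u)
      with that have "t \<notin> A \<or> u \<notin> B"
        by auto
      with 1 A(3) B(3) val show ?thesis
        by (auto simp: free_operad_circ_graft[OF f g i])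
    qed (simp add: free_operad_circ_outside)
  next
    show "?C \<subseteq> syntax_trees G (n + m - 1)"
      using A(2) B(2) by (auto simp del: One_nat_def intro!: graft_in_syntax_trees[OF i])
  qed (use A B in auto)
qed

lemma free_operad_circ_linear_left:
  assumes g: "g \<in> elems FG m" and i: "1 \<le> i" "i \<le> n"
  shows "linear_map R (space FG n) (space FG (n + m - 1)) (\<lambda>f. circ FG n m i f g)"
proof (rule linear_mapI)
  interpret F: module R "space FG n"
    unfolding free_operad_space by (rule module_free_module)
  fix f assume f: "f \<in> elems FG n"
  note val = free_module_value[OF f[unfolded free_operad_space]]
    free_module_value[OF g[unfolded free_operad_space]]
  show "circ FG n m i f g \<in> elems FG (n + m - 1)"
    using f g i by (rule free_operad_circ_closed)
  show "circ FG n m i (c \<odot>\<^bsub>space FG n\<^esub> f) g = c \<odot>\<^bsub>space FG (n + m - 1)\<^esub> circ FG n m i f g"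
    if c: "c \<in> carrier R" for c
    \<comment> \<open>The simplifier unfolds the module operations to pointwise functions, so the
      coefficient formula for the multiple is supplied in that unfolded form.\<close>
    using c val by (intro free_operad_circ_eqI)
      (auto simp: free_operad_circ_graft[OF f g i]
        free_operad_circ_graft[OF F.smult_closed[OF c f] g i,
          unfolded free_operad_space free_module_simps] free_operad_circ_outside
        free_operad_space free_module_simps m_assoc)
  fix f' assume f': "f' \<in> elems FG n"
  note val' = free_module_value[OF f'[unfolded free_operad_space]]
  show "circ FG n m i (f \<oplus>\<^bsub>space FG n\<^esub> f') g
      = circ FG n m i f g \<oplus>\<^bsub>space FG (n + m - 1)\<^esub> circ FG n m i f' g"
    using val val' by (intro free_operad_circ_eqI)
      (auto simp: free_operad_circ_graft[OF f g i] free_operad_circ_graft[OF f' g i]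
        free_operad_circ_graft[OF F.a_closed[OF f f'] g i,
          unfolded free_operad_space free_module_simps] free_operad_circ_outside
        free_operad_space free_module_simps l_distr)
qed

lemma free_operad_circ_linear_right:
  assumes f: "f \<in> elems FG n" and i: "1 \<le> i" "i \<le> n"
  shows "linear_map R (space FG m) (space FG (n + m - 1)) (\<lambda>g. circ FG n m i f g)"
proof (rule linear_mapI)
  interpret F: module R "space FG m"
    unfolding free_operad_space by (rule module_free_module)
  fix g assume g: "g \<in> elems FG m"
  note val = free_module_value[OF f[unfolded free_operad_space]]
    free_module_value[OF g[unfolded free_operad_space]]
  show "circ FG n m i f g \<in> elems FG (n + m - 1)"
    using f g i by (rule free_operad_circ_closed)
  show "circ FG n m i f (c \<odot>\<^bsub>space FG m\<^esub> g) = c \<odot>\<^bsub>space FG (n + m - 1)\<^esub> circ FG n m i f g"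
    if c: "c \<in> carrier R" for c
    using c val by (intro free_operad_circ_eqI)
      (auto simp: free_operad_circ_graft[OF f g i]
        free_operad_circ_graft[OF f F.smult_closed[OF c g] i,
          unfolded free_operad_space free_module_simps] free_operad_circ_outside
        free_operad_space free_module_simps m_lcomm)
  fix g' assume g': "g' \<in> elems FG m"
  note val' = free_module_value[OF g'[unfolded free_operad_space]]
  show "circ FG n m i f (g \<oplus>\<^bsub>space FG m\<^esub> g')
      = circ FG n m i f g \<oplus>\<^bsub>space FG (n + m - 1)\<^esub> circ FG n m i f g'"
    using val val' by (intro free_operad_circ_eqI)
      (auto simp: free_operad_circ_graft[OF f g i] free_operad_circ_graft[OF f g' i]
        free_operad_circ_graft[OF f F.a_closed[OF g g'] i,
          unfolded free_operad_space free_module_simps] free_operad_circ_outside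
        free_operad_space free_module_simps r_distr)
qed

lemma free_operad_basis_closed: "t \<in> syntax_trees G n \<Longrightarrow> basis_elem R t \<in> elems FG n"
  by (simp add: free_operad_space basis_elem_closed)

text \<open>By injectivity of grafting, the indicator function of \<open>graft t i u\<close>
  factors, on grafted trees, into those of \<open>t\<close> and \<open>u\<close>. The operad axioms
  of the free operad reduce to this formula.\<close>

lemma free_operad_circ_basis:
  assumes i: "1 \<le> i" "i \<le> n" and t: "t \<in> syntax_trees G n" and u: "u \<in> syntax_trees G m"
  shows "circ FG n m i (basis_elem R t) (basis_elem R u) = basis_elem R (graft t i u)"
proof (rule free_operad_circ_eqI)
  fix t' u' assume t': "t' \<in> syntax_trees G n" "u' \<in> syntax_trees G m"
  then have "graft t' i u' = graft t i u \<longleftrightarrow> t' = t \<and> u' = u"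
    using graft_inject[of t' i u' t u] i t u by (auto simp: syntax_trees_def)
  moreover have "circ FG n m i (basis_elem R t) (basis_elem R u) (graft t' i u')
      = basis_elem R t t' \<otimes> basis_elem R u u'"
    by (rule free_operad_circ_graft[OF free_operad_basis_closed[OF t]
          free_operad_basis_closed[OF u] i t'])
  ultimately show "circ FG n m i (basis_elem R t) (basis_elem R u) (graft t' i u')
      = basis_elem R (graft t i u) (graft t' i u')"
    by (auto simp: basis_elem_def)
next
  fix s assume "\<And>t u. t \<in> syntax_trees G n \<Longrightarrow> u \<in> syntax_trees G m \<Longrightarrow> s \<noteq> graft t i u"
  then show "basis_elem R (graft t i u) s = \<zero>"
    using t u by (auto simp: basis_elem_def)
qed

lemma module_free_operad: "module R (space FG n)"
  by (simp add: free_operad_space module_free_module)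

lemma free_operad_linear_eqI:
  assumes "module R N" and "linear_map R (space FG n) N f" and "linear_map R (space FG n) N g"
    and "\<And>t. t \<in> syntax_trees G n \<Longrightarrow> f (basis_elem R t) = g (basis_elem R t)"
    and "x \<in> elems FG n"
  shows "f x = g x"
  using linear_map_free_eqI assms unfolding free_operad_space by blast

end

end

context cring
begin

text \<open>With \<open>y\<close> fixed, linearity reduces \<open>x\<close> to a tree; with that
  tree fixed, it reduces \<open>y\<close> to a tree. Both sides are plain functions of two
  arguments, so composites of operad operations fit without a tensor product.\<close>

lemma free_operad_bilinear_eqI:
  assumes N: "module R N"
    and f1: "\<And>y. y \<in> elems (free_operad R H) m \<Longrightarrow> linear_map R (space (free_operad R G) n) N (\<lambda>x. f x y)"
    and g1: "\<And>y. y \<in> elems (free_operad R H) m \<Longrightarrow> linear_map R (space (free_operad R G) n) N (\<lambda>x. g x y)"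
    and f2: "\<And>x. x \<in> elems (free_operad R G) n \<Longrightarrow> linear_map R (space (free_operad R H) m) N (f x)"
    and g2: "\<And>x. x \<in> elems (free_operad R G) n \<Longrightarrow> linear_map R (space (free_operad R H) m) N (g x)"
    and basis: "\<And>t u. t \<in> syntax_trees G n \<Longrightarrow> u \<in> syntax_trees H m
      \<Longrightarrow> f (basis_elem R t) (basis_elem R u) = g (basis_elem R t) (basis_elem R u)"
    and x: "x \<in> elems (free_operad R G) n" and y: "y \<in> elems (free_operad R H) m"
  shows "f x y = g x y"
proof (rule free_operad_linear_eqI[OF N f1[OF y] g1[OF y] _ x])
  fix t assume t: "t \<in> syntax_trees G n"
  note t' = free_operad_basis_closed[OF t]
  show "f (basis_elem R t) y = g (basis_elem R t) y"
    by (rule free_operad_linear_eqI[OF N f2[OF t'] g2[OF t'] basis[OF t] y])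
qed

end

section \<open>Operad axioms for the free operad\<close>

context field
begin

lemma ns_operad_free_operad: "ns_operad R (free_operad R G)"
proof (rule ns_operad.intro)
  let ?F = "free_operad R G"
  note lin = free_operad_circ_linear_left free_operad_circ_linear_right
  note closed = free_operad_circ_closed
  note comp = linear_map_compose
  show "field R"
    by (rule field_axioms)
  show "module R (space ?F n)" for n
    by (rule module_free_operad)
  have Leaf: "Leaf \<in> syntax_trees G 1"
    by (simp add: syntax_trees_def)
  note unit = free_operad_basis_closed[OF Leaf]
  then show "operad_unit ?F \<in> elems ?F 1"
    by (simp add: free_operad_unit)
  fix n m p i j k :: nat
  show "linear_map R (space ?F n) (space ?F (n + m - 1)) (\<lambda>x. circ ?F n m i x y)"
    if "1 \<le> i" "i \<le> n" "y \<in> elems ?F m" for y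
    using that by (intro lin)
  show "linear_map R (space ?F m) (space ?F (n + m - 1)) (\<lambda>y. circ ?F n m i x y)"
    if "1 \<le> i" "i \<le> n" "x \<in> elems ?F n" for x
    using that by (intro lin)
  show "circ ?F 1 n 1 (operad_unit ?F) x = x" if "x \<in> elems ?F n" for x
  proof (rule free_operad_linear_eqI[OF module_free_operad _ _ _ that])
    show "linear_map R (space ?F n) (space ?F n) (\<lambda>x. circ ?F 1 n 1 (operad_unit ?F) x)"
      using lin(2)[OF unit, of 1 n] by (simp add: free_operad_unit)
    show "linear_map R (space ?F n) (space ?F n) (\<lambda>x. x)"
      by (rule linear_mapI) auto
    show "circ ?F 1 n 1 (operad_unit ?F) (basis_elem R t) = basis_elem R t"
      if "t \<in> syntax_trees G n" for t
      using free_operad_circ_basis[OF _ _ Leaf that] by (simp add: free_operad_unit)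
  qed
  show "circ ?F n 1 i x (operad_unit ?F) = x"
    if i: "1 \<le> i" "i \<le> n" and x: "x \<in> elems ?F n" for x
  proof (rule free_operad_linear_eqI[OF module_free_operad _ _ _ x])
    show "linear_map R (space ?F n) (space ?F n) (\<lambda>x. circ ?F n 1 i x (operad_unit ?F))"
      using lin(1)[OF unit i] by (simp add: free_operad_unit)
    show "linear_map R (space ?F n) (space ?F n) (\<lambda>x. x)"
      by (rule linear_mapI) auto
    show "circ ?F n 1 i (basis_elem R t) (operad_unit ?F) = basis_elem R t"
      if "t \<in> syntax_trees G n" for t
      using free_operad_circ_basis[OF i that Leaf] i that
      by (simp add: free_operad_unit graft_Leaf_right syntax_trees_def)
  qed
  show "circ ?F (n + m - 1) p (i + j - 1) (circ ?F n m i x y) z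
      = circ ?F n (m + p - 1) i x (circ ?F m p j y z)"
    if i: "1 \<le> i" "i \<le> n" and j: "1 \<le> j" "j \<le> m"
      and x: "x \<in> elems ?F n" and y: "y \<in> elems ?F m" and z: "z \<in> elems ?F p" for x y z
  proof -
    \<comment> \<open>The two sides are maps into components with differently written arities; the
      fact \<open>N\<close> identifies them.\<close>
    let ?N = "space ?F (n + (m + p - 1) - 1)"
    have ij: "1 \<le> i + j - 1" "i + j - 1 \<le> n + m - 1"
      and N: "space ?F (n + m - 1 + p - 1) = ?N"
      using i j by (auto simp: add.assoc)
    \<comment> \<open>Trilinearity is split into linearity in \<open>z\<close> for fixed trees
      \<open>t\<close> and \<open>u\<close>, and bilinearity in the other two arguments.\<close>
    have on_basis: "circ ?F (n + m - 1) p (i + j - 1) (circ ?F n m i (basis_elem R t) (basis_elem R u)) z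
        = circ ?F n (m + p - 1) i (basis_elem R t) (circ ?F m p j (basis_elem R u) z)"
      if t: "t \<in> syntax_trees G n" and u: "u \<in> syntax_trees G m" for t u
    proof (rule free_operad_linear_eqI[OF module_free_operad _ _ _ z])
      note t' = free_operad_basis_closed[OF t] and u' = free_operad_basis_closed[OF u]
      show "linear_map R (space ?F p) ?N
          (\<lambda>z. circ ?F (n + m - 1) p (i + j - 1) (circ ?F n m i (basis_elem R t) (basis_elem R u)) z)"
        using lin(2)[OF closed[OF t' u' i] ij, of p] unfolding N .
      show "linear_map R (space ?F p) ?N
          (\<lambda>z. circ ?F n (m + p - 1) i (basis_elem R t) (circ ?F m p j (basis_elem R u) z))"
        by (rule comp[OF lin(2)[OF u' j] lin(2)[OF t' i]])
      fix v assume v: "v \<in> syntax_trees G p"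
      show "circ ?F (n + m - 1) p (i + j - 1) (circ ?F n m i (basis_elem R t) (basis_elem R u)) (basis_elem R v)
        = circ ?F n (m + p - 1) i (basis_elem R t) (circ ?F m p j (basis_elem R u) (basis_elem R v))"
        unfolding free_operad_circ_basis[OF i t u] free_operad_circ_basis[OF j u v]
          free_operad_circ_basis[OF ij graft_in_syntax_trees[OF i t u] v]
          free_operad_circ_basis[OF i t graft_in_syntax_trees[OF j u v]]
        using graft_graft_sequential[of i t j u v] i j t u by (simp add: syntax_trees_def)
    qed
    show ?thesis
    proof (rule free_operad_bilinear_eqI[OF module_free_operad _ _ _ _ _ x y])
      show "linear_map R (space ?F n) ?N (\<lambda>x. circ ?F (n + m - 1) p (i + j - 1) (circ ?F n m i x y) z)"
        if "y \<in> elems ?F m" for y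
        using comp[OF lin(1)[OF that i] lin(1)[OF z ij]] unfolding N .
      show "linear_map R (space ?F n) ?N (\<lambda>x. circ ?F n (m + p - 1) i x (circ ?F m p j y z))"
        if "y \<in> elems ?F m" for y
        by (rule lin(1)[OF closed[OF that z j] i])
      show "linear_map R (space ?F m) ?N (\<lambda>y. circ ?F (n + m - 1) p (i + j - 1) (circ ?F n m i x y) z)"
        if "x \<in> elems ?F n" for x
        using comp[OF lin(2)[OF that i] lin(1)[OF z ij]] unfolding N .
      show "linear_map R (space ?F m) ?N (\<lambda>y. circ ?F n (m + p - 1) i x (circ ?F m p j y z))"
        if "x \<in> elems ?F n" for x
        by (rule comp[OF lin(1)[OF z j] lin(2)[OF that i]])
    qed (rule on_basis)
  qed
  show "circ ?F (n + m - 1) p (k + m - 1) (circ ?F n m i x y) z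
      = circ ?F (n + p - 1) m i (circ ?F n p k x z) y"
    if ik: "1 \<le> i" "i < k" "k \<le> n"
      and x: "x \<in> elems ?F n" and y: "y \<in> elems ?F m" and z: "z \<in> elems ?F p" for x y z
  proof -
    let ?N = "space ?F (n + p - 1 + m - 1)"
    have i: "1 \<le> i" "i \<le> n" and k: "1 \<le> k" "k \<le> n"
      and km: "1 \<le> k + m - 1" "k + m - 1 \<le> n + m - 1" and ip: "1 \<le> i" "i \<le> n + p - 1"
      and N: "space ?F (n + m - 1 + p - 1) = ?N"
      using ik by (auto simp: add.commute add.left_commute)
    have on_basis: "circ ?F (n + m - 1) p (k + m - 1) (circ ?F n m i (basis_elem R t) (basis_elem R u)) z
        = circ ?F (n + p - 1) m i (circ ?F n p k (basis_elem R t) z) (basis_elem R u)"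
      if t: "t \<in> syntax_trees G n" and u: "u \<in> syntax_trees G m" for t u
    proof (rule free_operad_linear_eqI[OF module_free_operad _ _ _ z])
      note t' = free_operad_basis_closed[OF t] and u' = free_operad_basis_closed[OF u]
      show "linear_map R (space ?F p) ?N
          (\<lambda>z. circ ?F (n + m - 1) p (k + m - 1) (circ ?F n m i (basis_elem R t) (basis_elem R u)) z)"
        using lin(2)[OF closed[OF t' u' i] km, of p] unfolding N .
      show "linear_map R (space ?F p) ?N
          (\<lambda>z. circ ?F (n + p - 1) m i (circ ?F n p k (basis_elem R t) z) (basis_elem R u))"
        by (rule comp[OF lin(2)[OF t' k] lin(1)[OF u' ip]])
      fix v assume v: "v \<in> syntax_trees G p"
      show "circ ?F (n + m - 1) p (k + m - 1) (circ ?F n m i (basis_elem R t) (basis_elem R u)) (basis_elem R v)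
        = circ ?F (n + p - 1) m i (circ ?F n p k (basis_elem R t) (basis_elem R v)) (basis_elem R u)"
        unfolding free_operad_circ_basis[OF i t u] free_operad_circ_basis[OF k t v]
          free_operad_circ_basis[OF km graft_in_syntax_trees[OF i t u] v]
          free_operad_circ_basis[OF ip graft_in_syntax_trees[OF k t v] u]
        using graft_graft_parallel[of i k t u v] ik t u by (simp add: syntax_trees_def)
    qed
    show ?thesis
    proof (rule free_operad_bilinear_eqI[OF module_free_operad _ _ _ _ _ x y])
      show "linear_map R (space ?F n) ?N (\<lambda>x. circ ?F (n + m - 1) p (k + m - 1) (circ ?F n m i x y) z)"
        if "y \<in> elems ?F m" for y
        using comp[OF lin(1)[OF that i] lin(1)[OF z km]] unfolding N .
      show "linear_map R (space ?F n) ?N (\<lambda>x. circ ?F (n + p - 1) m i (circ ?F n p k x z) y)"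
        if "y \<in> elems ?F m" for y
        by (rule comp[OF lin(1)[OF z k] lin(1)[OF that ip]])
      show "linear_map R (space ?F m) ?N (\<lambda>y. circ ?F (n + m - 1) p (k + m - 1) (circ ?F n m i x y) z)"
        if "x \<in> elems ?F n" for x
        using comp[OF lin(2)[OF that i] lin(1)[OF z km]] unfolding N .
      show "linear_map R (space ?F m) ?N (\<lambda>y. circ ?F (n + p - 1) m i (circ ?F n p k x z) y)"
        if "x \<in> elems ?F n" for x
        by (rule lin(2)[OF closed[OF that z k] ip])
    qed (rule on_basis)
  qed
qed

end

section \<open>Morphisms out of free operads\<close>

definition free_operad_map ::
  "('k, 'r) ring_scheme \<Rightarrow> 'g set \<Rightarrow> 'h set \<Rightarrow> ('g \<Rightarrow> 'h) \<Rightarrow> nat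
    \<Rightarrow> ('g tree \<Rightarrow> 'k) \<Rightarrow> 'h tree \<Rightarrow> 'k" where
  "free_operad_map K G H \<phi> n =
    (\<lambda>x\<in>elems (free_operad K G) n.
      linear_extension K (space (free_operad K H) n) (\<lambda>t. basis_elem K (map_tree \<phi> t)) x)"

text \<open>Grafting the right subtree first leaves the left leaf at position 1, so no position
  depends on the size of a subtree.\<close>

lemma Node_as_graft:
  "Node l a r = graft (graft (Node Leaf a Leaf) 2 r) 1 l"
  by simp

context field
begin

lemma node_in_syntax_trees: "a \<in> G \<Longrightarrow> Node Leaf a Leaf \<in> syntax_trees G 2"
  by (simp add: syntax_trees_def)

lemma generator_closed: "a \<in> G \<Longrightarrow> generator R a \<in> elems (free_operad R G) 2"
  unfolding generator_def by (intro free_operad_basis_closed node_in_syntax_trees)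

context
  fixes G :: "'g set" and H :: "'h set" and \<phi>
  assumes \<phi>: "\<phi> \<in> G \<rightarrow> H"
begin

lemma free_operad_map_basis:
  assumes "t \<in> syntax_trees G n"
  shows "free_operad_map R G H \<phi> n (basis_elem R t) = basis_elem R (map_tree \<phi> t)"
  using assms linear_extension_basis[where B = "syntax_trees G n" and h = "\<lambda>t. basis_elem R (map_tree \<phi> t)",
      OF module_free_operad free_operad_basis_closed[OF map_tree_in_syntax_trees[OF \<phi>]]]
  by (simp add: free_operad_map_def free_operad_basis_closed)

text \<open>Both sides of the compatibility with composition are bilinear and agree on trees by
  \<open>map_tree_graft\<close>. The work is done for the unrestricted extension \<open>?f\<close>;
  \<open>restrict_operad_homI\<close> supplies the restriction.\<close>

lemma free_operad_map_hom:
  "free_operad_map R G H \<phi> \<in> operad_hom R (free_operad R G) (free_operad R H)"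
proof -
  interpret G: ns_operad R "free_operad R G" by (rule ns_operad_free_operad)
  interpret H: ns_operad R "free_operad R H" by (rule ns_operad_free_operad)
  let ?f = "\<lambda>n. linear_extension R (space (free_operad R H) n) (\<lambda>t. basis_elem R (map_tree \<phi> t))"
  have lin: "linear_map R (space (free_operad R G) n) (space (free_operad R H) n) (?f n)" for n
    unfolding free_operad_space[of G]
    by (intro linear_extension_linear module_free_operad free_operad_basis_closed
        map_tree_in_syntax_trees[OF \<phi>])
  have f: "?f n (basis_elem R t) = basis_elem R (map_tree \<phi> t)" if "t \<in> syntax_trees G n" for n t
    using that free_operad_map_basis[OF that] by (simp add: free_operad_map_def free_operad_basis_closed)
  have "(\<lambda>n. restrict (?f n) (elems (free_operad R G) n))
      \<in> operad_hom R (free_operad R G) (free_operad R H)"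
  proof (rule G.restrict_operad_homI[OF lin])
    have "Leaf \<in> syntax_trees G 1"
      by (simp add: syntax_trees_def)
    from f[OF this] show "?f 1 (operad_unit (free_operad R G)) = operad_unit (free_operad R H)"
      by (simp add: free_operad_unit)
    fix n m i :: nat and x y
    assume i: "1 \<le> i" "i \<le> n" and x: "x \<in> elems (free_operad R G) n" and y: "y \<in> elems (free_operad R G) m"
    show "?f (n + m - 1) (circ (free_operad R G) n m i x y)
        = circ (free_operad R H) n m i (?f n x) (?f m y)"
    proof (rule free_operad_bilinear_eqI[OF module_free_operad _ _ _ _ _ x y])
      fix t u assume t: "t \<in> syntax_trees G n" and u: "u \<in> syntax_trees G m"
      show "?f (n + m - 1) (circ (free_operad R G) n m i (basis_elem R t) (basis_elem R u))
          = circ (free_operad R H) n m i (?f n (basis_elem R t)) (?f m (basis_elem R u))"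
        unfolding f[OF t] f[OF u] free_operad_circ_basis[OF i t u]
          f[OF graft_in_syntax_trees[OF i t u]] map_tree_graft
          free_operad_circ_basis[OF i map_tree_in_syntax_trees[OF \<phi> t] map_tree_in_syntax_trees[OF \<phi> u]] ..
    next
      fix y assume y: "y \<in> elems (free_operad R G) m"
      show "linear_map R (space (free_operad R G) n) (space (free_operad R H) (n + m - 1))
          (\<lambda>x. ?f (n + m - 1) (circ (free_operad R G) n m i x y))"
        by (rule linear_map_compose[OF G.circ_linear_left[OF i y] lin])
      show "linear_map R (space (free_operad R G) n) (space (free_operad R H) (n + m - 1))
          (\<lambda>x. circ (free_operad R H) n m i (?f n x) (?f m y))"
        by (rule linear_map_compose[OF lin H.circ_linear_left[OF i linear_map_closed[OF lin y]]])
    next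
      fix x assume x: "x \<in> elems (free_operad R G) n"
      show "linear_map R (space (free_operad R G) m) (space (free_operad R H) (n + m - 1))
          (\<lambda>y. ?f (n + m - 1) (circ (free_operad R G) n m i x y))"
        by (rule linear_map_compose[OF G.circ_linear_right[OF i x] lin])
      show "linear_map R (space (free_operad R G) m) (space (free_operad R H) (n + m - 1))
          (\<lambda>y. circ (free_operad R H) n m i (?f n x) (?f m y))"
        by (rule linear_map_compose[OF lin H.circ_linear_right[OF i linear_map_closed[OF lin x]]])
    qed
  qed
  then show ?thesis
    by (simp add: free_operad_map_def[abs_def])
qed

lemma free_operad_map_generator:
  "a \<in> G \<Longrightarrow> free_operad_map R G H \<phi> 2 (generator R a) = generator R (\<phi> a)"
  by (simp add: generator_def free_operad_map_basis node_in_syntax_trees)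

end

text \<open>The leaf is the unit, and \<open>Node_as_graft\<close> writes a larger tree as a
  composite of a generator with its subtrees. Structural induction thus forces the values on trees,
  and linearity forces the rest.\<close>

lemma free_operad_hom_unique:
  assumes P: "ns_operad R P"
    and E: "E \<in> operad_hom R (free_operad R G) P" and F: "F \<in> operad_hom R (free_operad R G) P"
    and gen: "\<And>a. a \<in> G \<Longrightarrow> E 2 (generator R a) = F 2 (generator R a)"
  shows "E = F"
proof (rule operad_hom_eqI[OF E F])
  interpret ns_operad R P by fact
  have "E n (basis_elem R t) = F n (basis_elem R t)" if "t \<in> syntax_trees G n" for n t
    using that
  proof (induction t arbitrary: n)
    case Leaf
    then have "n = 1"
      by (simp add: syntax_trees_def)
    then show ?case
      using operad_hom_unit[OF E] operad_hom_unit[OF F] by (simp add: free_operad_unit)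
  next
    case (Node l a r)
    \<comment> \<open>Arity of the intermediate tree, where only \<open>r\<close> has been grafted
      onto the generator.\<close>
    let ?k = "2 + size1 r - 1"
    have a: "a \<in> G" and l: "l \<in> syntax_trees G (size1 l)" and r: "r \<in> syntax_trees G (size1 r)"
      and n: "n = ?k + size1 l - 1"
      using Node.prems by (auto simp: syntax_trees_def)
    note node = node_in_syntax_trees[OF a]
    have i: "(1::nat) \<le> 2" "(2::nat) \<le> 2" "(1::nat) \<le> 1" "1 \<le> ?k"
      by auto
    note ar = graft_in_syntax_trees[OF i(1,2) node r]
    \<comment> \<open>The morphism is left open so that the same two equations serve
      \<open>E\<close> and \<open>F\<close>; composites of basis elements are already rewritten as
      grafts.\<close>
    note hom = operad_hom_circ[OF _ i(3,4) free_operad_basis_closed[OF ar] free_operad_basis_closed[OF l],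
          unfolded free_operad_circ_basis[OF i(3,4) ar l]]
      operad_hom_circ[OF _ i(1,2) free_operad_basis_closed[OF node] free_operad_basis_closed[OF r],
          unfolded free_operad_circ_basis[OF i(1,2) node r]]
    show ?case
      unfolding Node_as_graft[of l] n hom[OF E] hom[OF F]
      using Node.IH(1)[OF l] Node.IH(2)[OF r] gen[OF a] by (simp only: generator_def)
  qed
  then show "E n x = F n x" if "x \<in> elems (free_operad R G) n" for n x
    using that
    by (rule free_operad_linear_eqI[OF vector_space operad_hom_linear[OF E] operad_hom_linear[OF F]])
qed

text \<open>The composite and the identity are morphisms out of the free operad with the same values
  on generators, so \<open>free_operad_hom_unique\<close> replaces a computation with trees.\<close>

lemma free_operad_map_left_inverse:
  assumes \<phi>: "\<phi> \<in> G \<rightarrow> H" and \<psi>: "\<psi> \<in> H \<rightarrow> G" and inv: "\<And>a. a \<in> G \<Longrightarrow> \<psi> (\<phi> a) = a"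
    and x: "x \<in> elems (free_operad R G) n"
  shows "free_operad_map R H G \<psi> n (free_operad_map R G H \<phi> n x) = x"
proof -
  interpret G: ns_operad R "free_operad R G" by (rule ns_operad_free_operad)
  have "(\<lambda>n. compose (elems (free_operad R G) n) (free_operad_map R H G \<psi> n)
      (free_operad_map R G H \<phi> n)) = (\<lambda>n. \<lambda>x\<in>elems (free_operad R G) n. x)"
  proof (rule free_operad_hom_unique[OF ns_operad_free_operad
        G.operad_hom_compose[OF free_operad_map_hom[OF \<phi>] free_operad_map_hom[OF \<psi>]]
        G.operad_hom_ident])
    fix a assume a: "a \<in> G"
    then have "\<phi> a \<in> H"
      using \<phi> by auto
    with a show "compose (elems (free_operad R G) 2) (free_operad_map R H G \<psi> 2)
        (free_operad_map R G H \<phi> 2) (generator R a) = (\<lambda>x\<in>elems (free_operad R G) 2. x) (generator R a)"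
      by (simp add: compose_eq generator_closed free_operad_map_generator[OF \<phi>]
          free_operad_map_generator[OF \<psi>] inv)
  qed
  from fun_cong[OF this, of n, THEN fun_cong, of x] show ?thesis
    using x by (simp add: compose_def)
qed

end

section \<open>Morphisms between quotient operads\<close>

text \<open>The map on cosets induced by \<open>F\<close>. The union over representatives collapses
  to one coset when the morphism \<open>F\<close> sends \<open>I\<close> into
  \<open>I'\<close>.\<close>

definition quotient_operad_map ::
  "('k, 'x) operad \<Rightarrow> (nat \<Rightarrow> 'x set) \<Rightarrow> ('k, 'y) operad \<Rightarrow> (nat \<Rightarrow> 'y set)
    \<Rightarrow> (nat \<Rightarrow> 'x \<Rightarrow> 'y) \<Rightarrow> nat \<Rightarrow> 'x set \<Rightarrow> 'y set" where
  "quotient_operad_map P I P' I' F n =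
    (\<lambda>X\<in>elems (quotient_operad P I) n. \<Union>x\<in>X. I' n +>\<^bsub>space P' n\<^esub> F n x)"

context
  fixes K :: "('k, 'r) ring_scheme" and P :: "('k, 'x) operad" and P' :: "('k, 'y) operad" and I I' F
  assumes operads: "ns_operad K P" "ns_operad K P'"
    and ideals: "operad_ideal K P I" "operad_ideal K P' I'"
    and F: "F \<in> operad_hom K P P'" and F_ideal: "\<And>n x. x \<in> I n \<Longrightarrow> F n x \<in> I' n"
begin

interpretation P: ns_operad K P by (rule operads)
interpretation P': ns_operad K P' by (rule operads)

lemma quotient_operad_map_coset:
  assumes x: "x \<in> elems P n"
  shows "quotient_operad_map P I P' I' F n (I n +>\<^bsub>space P n\<^esub> x) = I' n +>\<^bsub>space P' n\<^esub> F n x"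
proof -
  have "(\<Union>y\<in>I n +>\<^bsub>space P n\<^esub> x. I' n +>\<^bsub>space P' n\<^esub> F n y) = I' n +>\<^bsub>space P' n\<^esub> F n x"
  proof (rule UN_coset[OF P.coset_facts[OF ideals(1)] x])
    fix h assume "h \<in> I n"
    then show "I' n +>\<^bsub>space P' n\<^esub> F n (h \<oplus>\<^bsub>space P n\<^esub> x) = I' n +>\<^bsub>space P' n\<^esub> F n x"
      using x P.ideal_subset[OF ideals(1)]
      by (simp add: linear_map_add[OF operad_hom_linear[OF F]] F_ideal operad_hom_closed[OF F]
          coset_shift[OF P'.coset_facts[OF ideals(2)]])
  qed
  then show ?thesis
    using P.quotient_elemsI[OF ideals(1) x] by (simp add: quotient_operad_map_def)
qed

lemma quotient_operad_map_hom:
  "quotient_operad_map P I P' I' F \<in> operad_hom K (quotient_operad P I) (quotient_operad P' I')"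
proof -
  interpret Q: ns_operad K "quotient_operad P I"
    using ideals(1) by (rule P.ns_operad_quotient)
  let ?f = "quotient_operad_map P I P' I' F"
  \<comment> \<open>The induced map already is a restriction; this makes it match the conclusion of
    \<open>restrict_operad_homI\<close>.\<close>
  have f: "restrict (?f n) (elems (quotient_operad P I) n) = ?f n" for n
    by (simp add: quotient_operad_map_def)
  have "(\<lambda>n. restrict (?f n) (elems (quotient_operad P I) n))
      \<in> operad_hom K (quotient_operad P I) (quotient_operad P' I')"
  proof (rule Q.restrict_operad_homI)
    show "linear_map K (space (quotient_operad P I) n) (space (quotient_operad P' I') n) (?f n)" for n
      unfolding P.space_quotient[OF ideals(1)] P'.space_quotient[OF ideals(2)]
      by (rule linear_map_quotientI[OF P.coset_facts[OF ideals(1)] P'.coset_facts[OF ideals(2)]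
            operad_hom_linear[OF F] quotient_operad_map_coset])
    show "?f 1 (operad_unit (quotient_operad P I)) = operad_unit (quotient_operad P' I')"
      unfolding P.unit_quotient[OF ideals(1)] P'.unit_quotient[OF ideals(2)]
        quotient_operad_map_coset[OF P.unit_in] operad_hom_unit[OF F] ..
    fix n m i X Y
    assume i: "1 \<le> i" "i \<le> n" and "X \<in> elems (quotient_operad P I) n" "Y \<in> elems (quotient_operad P I) m"
    then obtain x y where x: "x \<in> elems P n" "X = I n +>\<^bsub>space P n\<^esub> x"
      and y: "y \<in> elems P m" "Y = I m +>\<^bsub>space P m\<^esub> y"
      using P.quotient_elemsE[OF ideals(1)] by metis
    show "?f (n + m - 1) (circ (quotient_operad P I) n m i X Y)
        = circ (quotient_operad P' I') n m i (?f n X) (?f m Y)"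
      unfolding x(2) y(2) P.circ_quotient[OF ideals(1) i x(1) y(1)]
        quotient_operad_map_coset[OF x(1)] quotient_operad_map_coset[OF y(1)]
        quotient_operad_map_coset[OF P.circ_closed[OF i x(1) y(1)]]
        P'.circ_quotient[OF ideals(2) i operad_hom_closed[OF F x(1)] operad_hom_closed[OF F y(1)]]
        operad_hom_circ[OF F i x(1) y(1)] ..
  qed
  then show ?thesis
    by (simp add: f)
qed

end

section \<open>Relabelling the generators of a presentation\<close>

context field
begin

context
  fixes G :: "'g set" and Rel :: "nat \<Rightarrow> ('g tree \<Rightarrow> 'a) set"
  assumes Rel: "\<And>n. Rel n \<subseteq> elems (free_operad R G) n"
begin

lemma presented_ideal: "operad_ideal R (free_operad R G) (generated_ideal R (free_operad R G) Rel)"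
  using Rel by (rule ns_operad.generated_ideal_ideal[OF ns_operad_free_operad])

lemma ns_operad_presented: "ns_operad R (presented_operad R G Rel)"
  unfolding presented_operad_def
  using presented_ideal by (rule ns_operad.ns_operad_quotient[OF ns_operad_free_operad])

end

text \<open>Relabelling carries relations to relations in both directions, so by minimality each
  generated ideal is sent into the other, and the induced maps on the quotients are mutually
  inverse.\<close>

lemma isomorphic_presented_operad:
  fixes G :: "'g set" and H :: "'h set"
  assumes \<phi>: "\<phi> \<in> G \<rightarrow> H" and \<psi>: "\<psi> \<in> H \<rightarrow> G"
    and inv: "\<And>a. a \<in> G \<Longrightarrow> \<psi> (\<phi> a) = a" "\<And>b. b \<in> H \<Longrightarrow> \<phi> (\<psi> b) = b"
    and Rel: "\<And>n. Rel n \<subseteq> elems (free_operad R G) n"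
    and Rel': "\<And>n. Rel' n = free_operad_map R G H \<phi> n ` Rel n"
  shows "isomorphic_operads R (presented_operad R G Rel) (presented_operad R H Rel')"
proof -
  let ?G = "free_operad R G" and ?H = "free_operad R H"
  let ?E = "free_operad_map R G H \<phi>" and ?F = "free_operad_map R H G \<psi>"
  let ?I = "generated_ideal R ?G Rel" and ?J = "generated_ideal R ?H Rel'"
  interpret G: ns_operad R ?G by (rule ns_operad_free_operad)
  interpret H: ns_operad R ?H by (rule ns_operad_free_operad)
  note E = free_operad_map_hom[OF \<phi>] and F = free_operad_map_hom[OF \<psi>]
  have RelH: "Rel' n \<subseteq> elems ?H n" for n
    using Rel operad_hom_closed[OF E] unfolding Rel' by blast
  note I = presented_ideal[of Rel, OF Rel] and J = presented_ideal[of Rel', OF RelH]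
  have FE: "?F n (?E n x) = x" if "x \<in> elems ?G n" for n x
    using \<phi> \<psi> inv(1) that by (rule free_operad_map_left_inverse)
  have EF: "?E n (?F n y) = y" if "y \<in> elems ?H n" for n y
    using \<psi> \<phi> inv(2) that by (rule free_operad_map_left_inverse)
  have E_ideal: "?E n x \<in> ?J n" if "x \<in> ?I n" for n x
  proof (rule G.generated_ideal_hom[OF ns_operad_free_operad E J _ that])
    show "x \<in> elems ?G n \<and> ?E n x \<in> ?J n" if "x \<in> Rel n" for n x
      using that Rel generated_ideal_superset[of Rel' n R ?H] by (auto simp: Rel')
  qed
  have F_ideal: "?F n y \<in> ?I n" if "y \<in> ?J n" for n y
  proof (rule H.generated_ideal_hom[OF ns_operad_free_operad F I _ that])
    fix n y assume y: "y \<in> Rel' n"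
    then obtain x where x: "x \<in> Rel n" "y = ?E n x"
      by (auto simp: Rel')
    then have "?F n y = x"
      using Rel FE by blast
    then show "y \<in> elems ?H n \<and> ?F n y \<in> ?I n"
      using x y RelH generated_ideal_superset[of Rel n R ?G] by blast
  qed
  let ?E' = "quotient_operad_map ?G ?I ?H ?J ?E" and ?F' = "quotient_operad_map ?H ?J ?G ?I ?F"
  note EH = G.ns_operad_axioms H.ns_operad_axioms I J E E_ideal
    and FG = H.ns_operad_axioms G.ns_operad_axioms J I F F_ideal
  have "bij_betw (?E' n) (elems (quotient_operad ?G ?I) n) (elems (quotient_operad ?H ?J) n)" for n
  proof (rule bij_betw_byWitness[of _ "?F' n"])
    show "\<forall>X\<in>elems (quotient_operad ?G ?I) n. ?F' n (?E' n X) = X"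
      by (auto elim!: G.quotient_elemsE[OF I] simp: quotient_operad_map_coset[OF EH]
          quotient_operad_map_coset[OF FG] operad_hom_closed[OF E] FE)
    show "\<forall>Y\<in>elems (quotient_operad ?H ?J) n. ?E' n (?F' n Y) = Y"
      by (auto elim!: H.quotient_elemsE[OF J] simp: quotient_operad_map_coset[OF EH]
          quotient_operad_map_coset[OF FG] operad_hom_closed[OF F] EF)
    show "?E' n ` elems (quotient_operad ?G ?I) n \<subseteq> elems (quotient_operad ?H ?J) n"
      using operad_hom_closed[OF quotient_operad_map_hom[OF EH]] by auto
    show "?F' n ` elems (quotient_operad ?H ?J) n \<subseteq> elems (quotient_operad ?G ?I) n"
      using operad_hom_closed[OF quotient_operad_map_hom[OF FG]] by auto
  qed
  then show ?thesis
    unfolding isomorphic_operads_def presented_operad_def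
    using quotient_operad_map_hom[OF EH] by blast
qed

text \<open>\<open>binary_quadratic\<close> wants generators in the carrier type, here sets of
  functions on trees, so \<open>G\<close> has to be copied into that type. The injection
  \<open>\<phi>\<close> sends a label to the singleton of its generator, and the relations move
  along.\<close>

lemma binary_quadratic_presented_operad:
  fixes G :: "'g set"
  assumes Rel: "submodule Rel R (space (free_operad R G) 3)"
  shows "binary_quadratic R (presented_operad R G (concentrated 3 Rel))"
proof -
  define \<phi> :: "'g \<Rightarrow> ('g tree \<Rightarrow> 'a) set" where "\<phi> a = {generator R a}" for a
  have "inj \<phi>"
    \<comment> \<open>Generators with distinct labels differ at \<open>Node Leaf a Leaf\<close>, as
      one and zero are distinct in a field.\<close>
    by (rule injI) (auto simp: \<phi>_def generator_def basis_elem_def fun_eq_iff split: if_splits)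
  then have inv: "\<phi> \<in> G \<rightarrow> \<phi> ` G" "inv_into UNIV \<phi> \<in> \<phi> ` G \<rightarrow> G"
      "\<And>a. a \<in> G \<Longrightarrow> inv_into UNIV \<phi> (\<phi> a) = a"
      "\<And>b. b \<in> \<phi> ` G \<Longrightarrow> \<phi> (inv_into UNIV \<phi> b) = b"
    by auto
  let ?f = "free_operad_map R G (\<phi> ` G) \<phi> 3"
  have "submodule (?f ` Rel) R (space (free_operad R (\<phi> ` G)) 3)"
    by (rule submodule_image[OF module_free_operad module_free_operad
          operad_hom_linear[OF free_operad_map_hom[OF inv(1)]] Rel])
  moreover have "isomorphic_operads R (presented_operad R G (concentrated 3 Rel))
      (presented_operad R (\<phi> ` G) (concentrated 3 (?f ` Rel)))"
    using module.submoduleE(1)[OF module_free_operad Rel]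
    by (intro isomorphic_presented_operad[OF inv]) (auto simp: concentrated_def)
  ultimately show ?thesis
    unfolding binary_quadratic_def by blast
qed

end

section \<open>The functor\<close>

lemma poset_homD:
  assumes "\<phi> \<in> poset_hom Q1 Q2"
  shows poset_hom_Field: "\<phi> \<in> Field Q1 \<rightarrow> Field Q2"
    and poset_hom_mono: "(a, b) \<in> Q1 \<Longrightarrow> (\<phi> a, \<phi> b) \<in> Q2"
    and poset_hom_extensional: "\<phi> \<in> extensional (Field Q1)"
  using assms by (auto simp: poset_hom_def compat_def PiE_def)

lemma poset_hom_comparable:
  "\<phi> \<in> poset_hom Q1 Q2 \<Longrightarrow> comparable Q1 a b \<Longrightarrow> comparable Q2 (\<phi> a) (\<phi> b)"
  using poset_hom_mono by (fastforce simp: comparable_def)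

text \<open>The one critical case is that \<open>(a, b)\<close> is not in \<open>Q1\<close> although
  \<open>(\<phi> a, \<phi> b)\<close> is in \<open>Q2\<close>: the source picks \<open>b\<close>,
  the target \<open>\<phi> a\<close>. Comparability then puts \<open>b\<close> below
  \<open>a\<close>, so \<open>\<phi> b\<close> is below \<open>\<phi> a\<close> and antisymmetry
  makes them equal.\<close>

lemma poset_hom_min:
  assumes "\<phi> \<in> poset_hom Q1 Q2" and "antisym Q2" and "comparable Q1 a b"
  shows "\<phi> (poset_min Q1 a b) = poset_min Q2 (\<phi> a) (\<phi> b)"
  using assms(2,3) poset_hom_mono[OF assms(1)]
  by (auto simp: comparable_def poset_min_def dest: antisymD)

lemma comparable_Field:
  assumes "comparable Q a b"
  shows "a \<in> Field Q" and "b \<in> Field Q" and "poset_min Q a b \<in> Field Q"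
  using assms by (auto simp: comparable_def poset_min_def Field_def)

lemma category_finite_posets: "category (finite_posets :: ('a rel, 'a \<Rightarrow> 'a) cat)"
proof
  fix W X Y Z :: "'a rel" and f g h :: "'a \<Rightarrow> 'a"
  show "cat.ident finite_posets X \<in> Hom finite_posets X X"
    by (auto simp: finite_posets_def poset_hom_def compat_def Field_def)
  show "cat.comp finite_posets X Y Z g f \<in> Hom finite_posets X Z"
    if "f \<in> Hom finite_posets X Y" "g \<in> Hom finite_posets Y Z"
    using that by (auto simp: finite_posets_def poset_hom_def compat_def compose_def Field_def
        PiE_iff)
  show "cat.comp finite_posets X Y Y (cat.ident finite_posets Y) f = f"
    if "f \<in> Hom finite_posets X Y"
    using that Id_compose[OF poset_hom_Field poset_hom_extensional, of f X Y]
    by (simp add: finite_posets_def)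
  show "cat.comp finite_posets X X Y f (cat.ident finite_posets X) = f"
    if "f \<in> Hom finite_posets X Y"
    using that compose_Id[OF poset_hom_Field poset_hom_extensional, of f X Y]
    by (simp add: finite_posets_def)
  show "cat.comp finite_posets W X Z (cat.comp finite_posets X Y Z h g) f
      = cat.comp finite_posets W Y Z h (cat.comp finite_posets W X Y g f)"
    if "f \<in> Hom finite_posets W X"
    using that poset_homD[of f W X]
    by (auto simp: finite_posets_def compose_assoc)
qed

lemma category_binary_quadratic_operads:
  "category (binary_quadratic_operads K :: (('k, 'x) operad, nat \<Rightarrow> 'x \<Rightarrow> 'x) cat)"
proof
  let ?C = "binary_quadratic_operads K :: (('k, 'x) operad, nat \<Rightarrow> 'x \<Rightarrow> 'x) cat"
  fix W X Y Z :: "('k, 'x) operad" and f g h :: "nat \<Rightarrow> 'x \<Rightarrow> 'x"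
  show "cat.ident ?C X \<in> Hom ?C X X" if "X \<in> Obj ?C"
    using that ns_operad.operad_hom_ident by (auto simp: binary_quadratic_operads_def)
  show "cat.comp ?C X Y Z g f \<in> Hom ?C X Z"
    if "X \<in> Obj ?C" "f \<in> Hom ?C X Y" "g \<in> Hom ?C Y Z"
    using that ns_operad.operad_hom_compose by (auto simp: binary_quadratic_operads_def)
  show "cat.comp ?C X Y Y (cat.ident ?C Y) f = f" if "f \<in> Hom ?C X Y"
    using that Id_compose[OF operad_hom_funcset[of f K X Y] operad_hom_extensional[of f K X Y]]
    by (simp add: binary_quadratic_operads_def)
  show "cat.comp ?C X X Y f (cat.ident ?C X) = f" if "f \<in> Hom ?C X Y"
    using that compose_Id[OF operad_hom_funcset[of f K X Y] operad_hom_extensional[of f K X Y]]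
    by (simp add: binary_quadratic_operads_def)
  show "cat.comp ?C W X Z (cat.comp ?C X Y Z h g) f = cat.comp ?C W Y Z h (cat.comp ?C W X Y g f)"
    if "f \<in> Hom ?C W X"
    using that by (simp add: binary_quadratic_operads_def compose_assoc[OF operad_hom_funcset])
qed

section \<open>Operads of posets and the morphisms between them\<close>

context field
begin

abbreviation (input) "As_ideal Q \<equiv> generated_ideal R (free_operad R (Field Q)) (As_relations R Q)"

lemma As_relators_closed: "As_relators R Q \<subseteq> elems (free_operad R (Field Q)) 3"
proof -
  interpret F: ns_operad R "free_operad R (Field Q)" by (rule ns_operad_free_operad)
  interpret M: module R "space (free_operad R (Field Q)) 3" by (rule module_free_operad)
  have "circ (free_operad R (Field Q)) 2 2 i (generator R a) (generator R b)
      \<in> elems (free_operad R (Field Q)) 3"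
    if "i = 1 \<or> i = 2" "a \<in> Field Q" "b \<in> Field Q" for i a b
    using that F.circ_closed[of i 2 "generator R a" "generator R b" 2]
      generator_closed[of a "Field Q"] generator_closed[of b "Field Q"] by auto
  then show ?thesis
    by (auto simp: As_relators_def Let_def comparable_Field intro!: M.minus_closed)
qed

lemma submodule_As_relations:
  "submodule (linear_span R (space (free_operad R (Field Q)) 3) (As_relators R Q)) R
    (space (free_operad R (Field Q)) 3)"
  by (rule linear_span_submodule[OF module_free_operad As_relators_closed])

lemma As_relations_closed: "As_relations R Q n \<subseteq> elems (free_operad R (Field Q)) n"
  using module.submoduleE(1)[OF module_free_operad submodule_As_relations]
  by (auto simp: As_relations_def concentrated_def)

lemmas As_ideal = presented_ideal[of "As_relations R Q" "Field Q" for Q, OF As_relations_closed]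

lemma ns_operad_As: "ns_operad R (As R Q)"
  unfolding As_def using As_relations_closed by (rule ns_operad_presented)

lemma binary_quadratic_As: "binary_quadratic R (As R Q)"
  unfolding As_def As_relations_def
  by (rule binary_quadratic_presented_operad[OF submodule_As_relations])

text \<open>The projection from the free operad is surjective, so a morphism out of
  \<open>As R Q\<close> is known from its composite with the projection, and that composite is known
  from its values on generators.\<close>

lemma As_hom_unique:
  assumes P: "ns_operad R P" and E: "E \<in> operad_hom R (As R Q) P" and F: "F \<in> operad_hom R (As R Q) P"
    and star: "\<And>a. a \<in> Field Q \<Longrightarrow> E 2 (star R Q a) = F 2 (star R Q a)"
  shows "E = F"
proof (rule operad_hom_eqI[OF E F])
  let ?F = "free_operad R (Field Q)"
  interpret F: ns_operad R ?F by (rule ns_operad_free_operad)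
  let ?p = "\<lambda>n. \<lambda>x\<in>elems ?F n. As_ideal Q n +>\<^bsub>space ?F n\<^esub> x"
  have p: "?p \<in> operad_hom R ?F (As R Q)"
    unfolding As_def presented_operad_def by (rule F.coset_hom[OF As_ideal])
  have "(\<lambda>n. compose (elems ?F n) (E n) (?p n)) = (\<lambda>n. compose (elems ?F n) (F n) (?p n))"
    using star by (intro free_operad_hom_unique[OF P F.operad_hom_compose[OF p E] F.operad_hom_compose[OF p F]])
      (simp add: compose_eq generator_closed star_def Let_def)
  then have Ep: "compose (elems ?F n) (E n) (?p n) x = compose (elems ?F n) (F n) (?p n) x" for n x
    by (rule fun_cong[THEN fun_cong])
  fix n X assume "X \<in> elems (As R Q) n"
  then obtain x where "x \<in> elems ?F n" "X = As_ideal Q n +>\<^bsub>space ?F n\<^esub> x"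
    unfolding As_def presented_operad_def by (rule F.quotient_elemsE[OF As_ideal])
  then show "E n X = F n X"
    using Ep[of n x] by (simp add: compose_eq)
qed

text \<open>A relator for \<open>a\<close> and \<open>b\<close> goes to the relator of the same
  family for \<open>\<phi> a\<close> and \<open>\<phi> b\<close>, which are again comparable and
  whose minimum is the image of the minimum.\<close>

lemma As_relators_image:
  assumes \<phi>: "\<phi> \<in> poset_hom Q1 Q2" and "antisym Q2" and x: "x \<in> As_relators R Q1"
  shows "free_operad_map R (Field Q1) (Field Q2) \<phi> 3 x \<in> As_relators R Q2"
proof -
  let ?F = "free_operad_map R (Field Q1) (Field Q2) \<phi>"
  let ?P1 = "free_operad R (Field Q1)" and ?P2 = "free_operad R (Field Q2)"
  interpret P1: ns_operad R ?P1 by (rule ns_operad_free_operad)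
  note F = free_operad_map_hom[OF poset_hom_Field[OF \<phi>]]
  have circ: "?F 3 (circ ?P1 2 2 i (generator R a) (generator R b))
        = circ ?P2 2 2 i (generator R (\<phi> a)) (generator R (\<phi> b))"
      "circ ?P1 2 2 i (generator R a) (generator R b) \<in> elems ?P1 3"
    if "i = 1 \<or> i = 2" "a \<in> Field Q1" "b \<in> Field Q1" for i a b
    using that operad_hom_circ[OF F, of i 2 "generator R a" "generator R b" 2]
      P1.circ_closed[of i 2 "generator R a" "generator R b" 2]
    by (auto simp: generator_closed free_operad_map_generator[OF poset_hom_Field[OF \<phi>]])
  \<comment> \<open>Four independent labels cover both families, in which the minimum stands on
    opposite sides of the difference.\<close>
  have minus: "?F 3 (circ ?P1 2 2 1 (generator R a) (generator R b)
        \<ominus>\<^bsub>space ?P1 3\<^esub> circ ?P1 2 2 2 (generator R c) (generator R d))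
      = circ ?P2 2 2 1 (generator R (\<phi> a)) (generator R (\<phi> b))
        \<ominus>\<^bsub>space ?P2 3\<^esub> circ ?P2 2 2 2 (generator R (\<phi> c)) (generator R (\<phi> d))"
    if "a \<in> Field Q1" "b \<in> Field Q1" "c \<in> Field Q1" "d \<in> Field Q1" for a b c d
    using that circ by (simp add: linear_map_minus[OF module_free_operad module_free_operad operad_hom_linear[OF F]])
  note min = poset_hom_min[OF \<phi> assms(2)]
  have "?F 3 (circ ?P1 2 2 1 (generator R a) (generator R b) \<ominus>\<^bsub>space ?P1 3\<^esub>
        circ ?P1 2 2 2 (generator R (poset_min Q1 a b)) (generator R (poset_min Q1 a b)))
      \<in> As_relators R Q2"
    "?F 3 (circ ?P1 2 2 1 (generator R (poset_min Q1 a b)) (generator R (poset_min Q1 a b))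
        \<ominus>\<^bsub>space ?P1 3\<^esub> circ ?P1 2 2 2 (generator R a) (generator R b)) \<in> As_relators R Q2"
    if "comparable Q1 a b" for a b
    unfolding minus[OF comparable_Field(1,2)[OF that] comparable_Field(3,3)[OF that]]
      minus[OF comparable_Field(3,3)[OF that] comparable_Field(1,2)[OF that]]
      min[OF that] As_relators_def Let_def
    using poset_hom_comparable[OF \<phi> that] by blast+
  with x show ?thesis
    unfolding As_relators_def[of R Q1] Let_def by blast
qed

text \<open>The preimage of the target ideal is an ideal; it contains the relators, hence their
  span, since its components are subspaces, and hence the generated ideal.\<close>

lemma As_ideal_image:
  assumes \<phi>: "\<phi> \<in> poset_hom Q1 Q2" and "antisym Q2" and x: "x \<in> As_ideal Q1 n"
  shows "free_operad_map R (Field Q1) (Field Q2) \<phi> n x \<in> As_ideal Q2 n"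
proof -
  let ?F = "free_operad_map R (Field Q1) (Field Q2) \<phi>"
  let ?P1 = "free_operad R (Field Q1)" and ?P2 = "free_operad R (Field Q2)"
  interpret P1: ns_operad R ?P1 by (rule ns_operad_free_operad)
  note F = free_operad_map_hom[OF poset_hom_Field[OF \<phi>]]
  have relators: "As_relators R Q2 \<subseteq> As_ideal Q2 3"
    using generated_ideal_superset[of "As_relations R Q2" 3] linear_span_superset
    unfolding As_relations_def concentrated_def by fastforce
  have "linear_span R (space ?P1 3) (As_relators R Q1) \<subseteq> {x \<in> elems ?P1 3. ?F 3 x \<in> As_ideal Q2 3}"
    using As_relators_closed As_relators_image[OF \<phi> assms(2)] relators
    by (intro linear_span_least ideal_submodule[OF P1.preimage_ideal[OF ns_operad_free_operad F As_ideal]])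
      blast
  then have "x \<in> elems ?P1 n \<and> ?F n x \<in> As_ideal Q2 n" if "x \<in> As_relations R Q1 n" for n x
    using that by (auto simp: As_relations_def concentrated_def split: if_splits)
  then show ?thesis
    using P1.generated_ideal_hom[OF ns_operad_free_operad F As_ideal _ x] by blast
qed

lemma ex_extends_on_generators:
  assumes \<phi>: "\<phi> \<in> poset_hom Q1 Q2" and "antisym Q2"
  shows "\<exists>F. extends_on_generators R Q1 Q2 \<phi> F"
proof -
  note facts = ns_operad_free_operad ns_operad_free_operad As_ideal As_ideal
    free_operad_map_hom[OF poset_hom_Field[OF \<phi>]] As_ideal_image[OF assms]
  let ?F = "quotient_operad_map (free_operad R (Field Q1)) (As_ideal Q1)
    (free_operad R (Field Q2)) (As_ideal Q2) (free_operad_map R (Field Q1) (Field Q2) \<phi>)"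
  have "?F 2 (star R Q1 a) = star R Q2 (\<phi> a)" if "a \<in> Field Q1" for a
    using that by (simp add: star_def Let_def quotient_operad_map_coset[OF facts] generator_closed
        free_operad_map_generator[OF poset_hom_Field[OF \<phi>]])
  then have "extends_on_generators R Q1 Q2 \<phi> ?F"
    unfolding extends_on_generators_def As_def presented_operad_def
    using quotient_operad_map_hom[OF facts] by blast
  then show ?thesis
    by blast
qed

lemma extends_on_generators_unique:
  assumes "extends_on_generators R Q1 Q2 \<phi> E" and "extends_on_generators R Q1 Q2 \<phi> F"
  shows "E = F"
  using assms unfolding extends_on_generators_def by (intro As_hom_unique[OF ns_operad_As]) auto

lemma extends_on_generators_As_map:
  assumes "\<phi> \<in> poset_hom Q1 Q2" and "antisym Q2"
  shows "extends_on_generators R Q1 Q2 \<phi> (As_map R Q1 Q2 \<phi>)"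
  unfolding As_map_def
  using ex_extends_on_generators[OF assms] extends_on_generators_unique by (metis theI)

text \<open>Turns each functor law into the task of exhibiting one morphism with the prescribed
  values on the generators.\<close>

lemma As_map_eqI: "extends_on_generators R Q1 Q2 \<phi> F \<Longrightarrow> As_map R Q1 Q2 \<phi> = F"
  unfolding As_map_def using extends_on_generators_unique by blast

lemma star_closed: "a \<in> Field Q \<Longrightarrow> star R Q a \<in> elems (As R Q) 2"
  unfolding star_def Let_def As_def presented_operad_def
  by (intro ns_operad.quotient_elemsI[OF ns_operad_free_operad As_ideal] generator_closed)

lemma extends_on_generators_ident:
  "extends_on_generators R Q Q (\<lambda>x\<in>Field Q. x) (\<lambda>n. \<lambda>x\<in>elems (As R Q) n. x)"
  using ns_operad.operad_hom_ident[OF ns_operad_As]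
  by (auto simp: extends_on_generators_def star_closed)

text \<open>The hypothesis on \<open>\<phi>\<close> puts \<open>\<phi> x\<close> into
  \<open>Field Q2\<close>, where the values of \<open>F\<close> on stars are prescribed.\<close>

lemma extends_on_generators_compose:
  assumes "extends_on_generators R Q1 Q2 \<phi> E" and "extends_on_generators R Q2 Q3 \<psi> F"
    and "\<phi> \<in> Field Q1 \<rightarrow> Field Q2"
  shows "extends_on_generators R Q1 Q3 (compose (Field Q1) \<psi> \<phi>)
    (\<lambda>n. compose (elems (As R Q1) n) (F n) (E n))"
  using assms ns_operad.operad_hom_compose[OF ns_operad_As]
  by (auto simp: extends_on_generators_def star_closed compose_eq)

lemma is_functor_As:
  "is_functor (finite_posets :: ('c rel, 'c \<Rightarrow> 'c) cat) (binary_quadratic_operads R) (As R) (As_map R)"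
proof (intro is_functor.intro category_finite_posets category_binary_quadratic_operads is_functor_axioms.intro)
  note ext = extends_on_generators_As_map
  fix X Y Z :: "'c rel" and f g
  assume X: "X \<in> Obj finite_posets"
  show "As R X \<in> Obj (binary_quadratic_operads R)"
    by (simp add: binary_quadratic_operads_def ns_operad_As binary_quadratic_As)
  show "As_map R X X (cat.ident finite_posets X) = cat.ident (binary_quadratic_operads R) (As R X)"
    using As_map_eqI[OF extends_on_generators_ident]
    by (simp add: finite_posets_def binary_quadratic_operads_def)
  assume Y: "Y \<in> Obj finite_posets" and f: "f \<in> Hom finite_posets X Y"
  \<comment> \<open>Antisymmetry of the target order is what the compatibility of \<open>f\<close>
    with minima requires.\<close>
  have f': "f \<in> poset_hom X Y" "antisym Y"
    using Y f by (auto simp: finite_posets_def partial_order_on_def)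
  show "As_map R X Y f \<in> Hom (binary_quadratic_operads R) (As R X) (As R Y)"
    using ext[OF f'] by (simp add: extends_on_generators_def binary_quadratic_operads_def)
  assume "Z \<in> Obj finite_posets" and "g \<in> Hom finite_posets Y Z"
  then have g': "g \<in> poset_hom Y Z" "antisym Z"
    by (auto simp: finite_posets_def partial_order_on_def)
  show "As_map R X Z (cat.comp finite_posets X Y Z g f)
      = cat.comp (binary_quadratic_operads R) (As R X) (As R Y) (As R Z) (As_map R Y Z g) (As_map R X Y f)"
    using As_map_eqI[OF extends_on_generators_compose[OF ext[OF f'] ext[OF g'] poset_hom_Field[OF f'(1)]]]
    by (simp add: finite_posets_def binary_quadratic_operads_def)
qed

end

theorem theorem2p3:
  fixes K :: "('k, 'r) ring_scheme"
  assumes "field K"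
    and char_zero: "\<And>n::nat. n > 0 \<Longrightarrow> [n] \<cdot>\<^bsub>K\<^esub> \<one>\<^bsub>K\<^esub> \<noteq> \<zero>\<^bsub>K\<^esub>"
  shows "is_functor (finite_posets :: ('a rel, 'a \<Rightarrow> 'a) cat) (binary_quadratic_operads K)
           (As K) (As_map K)
       \<and> (\<forall>(Q1 :: 'a rel) Q2 \<phi>.
            Q1 \<in> Obj finite_posets \<and> Q2 \<in> Obj finite_posets \<and> \<phi> \<in> Hom finite_posets Q1 Q2 \<longrightarrow>
              (\<exists>!F. extends_on_generators K Q1 Q2 \<phi> F) \<and>
              extends_on_generators K Q1 Q2 \<phi> (As_map K Q1 Q2 \<phi>))"
proof (intro conjI allI impI)
  interpret field K by fact
  show "is_functor (finite_posets :: ('a rel, 'a \<Rightarrow> 'a) cat) (binary_quadratic_operads K) (As K) (As_map K)"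
    by (rule is_functor_As)
  fix Q1 Q2 :: "'a rel" and \<phi>
  assume "Q1 \<in> Obj finite_posets \<and> Q2 \<in> Obj finite_posets \<and> \<phi> \<in> Hom finite_posets Q1 Q2"
  then have "\<phi> \<in> poset_hom Q1 Q2" "antisym Q2"
    by (auto simp: finite_posets_def partial_order_on_def)
  then show *: "extends_on_generators K Q1 Q2 \<phi> (As_map K Q1 Q2 \<phi>)"
    by (rule extends_on_generators_As_map)
  show "\<exists>!F. extends_on_generators K Q1 Q2 \<phi> F"
    using * extends_on_generators_unique by blast
qed

end
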